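(* Let $\Omega\subseteq\mathbb{R}^d$ be a bounded open set, $n,m\ge1$, let $\rho_1,\dots,\rho_n$ be positive functions of $\varepsilon>0$ with $\rho_k(\varepsilon)\to0$ as $\varepsilon\to0^+$ for every $k$ and $\lim_{\varepsilon\to0^+}\rho_{k+1}(\varepsilon)/\rho_k(\varepsilon)=0$ for $k=1,\dots,n-1$, and let $\varepsilon_h\to0^+$ be a fixed sequence. Let $u_h$ be a bounded sequence in $L^q(\Omega,\mathbb{R}^m)$, $q\in[1,+\infty)$, generating a multiscale Young measure $\nu$, and let $f:\Omega\times\square^n\times\mathbb{R}^m\to[0,+\infty)$ be an admissible integrand satisfying $$f(x,y^1,\dots,y^n,z)\le c\,(1+|z|^q)$$ for some $c>0$ and for all $(x,y^1,\dots,y^n,z)\in\Omega\times\square^n\times\mathbb{R}^m$. Set $$w_h(x):=\Bigl(\Bigl\langle\frac{x}{\rho_1(\varepsilon_h)}\Bigr\rangle,\dots,\Bigl\langle\frac{x}{\rho_n(\varepsilon_h)}\Bigr\rangle,u_h(x)\Bigr).$$ Then $$\liminf_{h\to+\infty}\int_\Omega f\bigl(x,w_h(x)\bigr)\,dx\ \ge\ \int_{\Omega\times\square^n}\overline f(x,y^1,\dots,y^n)\,dx\,dy^1\cdots dy^n,$$ where $$\overline f(x,y^1,\dots,y^n):=\int_{\mathbb{R}^m}f(x,y^1,\dots,y^n,z)\,d\nu_{(x,y^1,\dots,y^n)}(z).$$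
   Context: $\square=[0,1)^d$; $\langle\cdot\rangle$ is the componentwise fractional part; $|A|$ is the Lebesgue measure of $A$; $T$ denotes $\square$ with the topology of the $d$-dimensional torus. Admissible integrand: $f:\Omega\times\square^n\times\mathbb{R}^m\to[0,+\infty)$ such that for every $\delta>0$ there exist a compact set $X\subseteq\Omega$ with $|\Omega\setminus X|\le\delta$ and a compact set $Y\subseteq\square$ with $|\square\setminus Y|\le\delta$ such that $f|_{X\times Y^n\times\mathbb{R}^m}$ is continuous. Young measures: for a bounded measurable $D\subseteq\mathbb{R}^l$ and a locally compact, complete, separable metric space $S$, $\mathcal{Y}(D,S)$ is the set of (a.e.-equivalence classes of) weak* measurable maps $x\mapsto\mu_x$ from $D$ to the Radon measures on $S$ with $\mu_x$ a probability measure for a.e. $x$ (weak* measurable: $x\mapsto\int_S\phi\,d\mu_x$ is measurable for all $\phi\in C_0(S)$). A sequence of measurable maps $w_h:D\to S$ generates the Young measure $\mu$ if $\int_D\phi_x(w_h(x))\,dx\to\int_D\int_S\phi_x\,d\mu_x\,dx$ for all $\phi\in L^1(D,C_0(S))$. Multiscale Young measure: let $u_h$ be bounded in $L^1(\Omega,\mathbb{R}^m)$ and let $w_h:\Omega\to T^n\times\mathbb{R}^m$ be as in the statement. We say $u_h$ generates the multiscale Young measure $\nu\in\mathcal{Y}(\Omega\times\square^n,\mathbb{R}^m)$ if $w_h$ generates a Young measure $\mu\in\mathcal{Y}(\Omega,T^n\times\mathbb{R}^m)$ and $\nu$ is the (a.e. unique) element of $\mathcal{Y}(\Omega\times\square^n,\mathbb{R}^m)$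 such that $\int_\Omega\int_{\square^n\times\mathbb{R}^m}g(x,y,z)\,d\mu_x(y,z)\,dx=\int_{\Omega\times\square^n}\int_{\mathbb{R}^m}g(x,y,z)\,d\nu_{(x,y)}(z)\,dx\,dy$ for all non-negative $g$ measurable with respect to the product of the Lebesgue $\sigma$-algebra of $\Omega$ and the Borel $\sigma$-algebra of $T^n\times\mathbb{R}^m$. (Such a $\nu$ exists whenever $w_h$ generates a Young measure.) *)

theory Defs
  imports "HOL-Probability.Probability"
begin

section \<open>The unit cube, the torus and the scales\<close>

definition unit_cube :: "(real ^ 'd) set" where
  "unit_cube = {y. \<forall>i. 0 \<le> y $ i \<and> y $ i < 1}"

definition unit_cubes :: "((real ^ 'd) ^ 'n) set" where
  "unit_cubes = {y. \<forall>k. y $ k \<in> unit_cube}"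

definition frac_vec :: "(real ^ 'd) \<Rightarrow> (real ^ 'd)" where
  "frac_vec x = (\<chi> i. frac (x $ i))"

text \<open>The quotient topology of the map \<^term>\<open>frac_vec\<close> onto the unit cube; its fibres are
  the cosets of the integer lattice.\<close>

definition torus :: "(real ^ 'd) topology" where
  "torus = topology (\<lambda>U. U \<subseteq> unit_cube \<and> open (frac_vec -` U))"

lemma openin_torus:
  fixes U :: "(real ^ 'd) set"
  shows "openin torus U \<longleftrightarrow> U \<subseteq> unit_cube \<and> open (frac_vec -` U)"
proof -
  have "istopology (\<lambda>U::(real ^ 'd) set. U \<subseteq> unit_cube \<and> open (frac_vec -` U))"
    unfolding istopology_def by (auto simp: vimage_Union open_Int)
  then show ?thesis
    by (simp add: torus_def)
qed

lemma frac_vec_in_unit_cube: "frac_vec x \<in> unit_cube"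
  by (simp add: unit_cube_def frac_vec_def frac_lt_1)

lemma topspace_torus: "topspace torus = (unit_cube :: (real ^ 'd) set)"
proof -
  have "frac_vec -` unit_cube = (UNIV :: (real ^ 'd) set)"
    using frac_vec_in_unit_cube by auto
  then have "openin torus (unit_cube :: (real ^ 'd) set)"
    by (simp add: openin_torus)
  then show ?thesis
    by (meson openin_subset openin_topspace openin_torus subset_antisym)
qed

text \<open>The product topology on the \<open>n\<close>-th power of the torus, carried over from functions
  to vectors along the injection \<^term>\<open>vec_nth\<close>.\<close>

definition torus_power :: "((real ^ 'd) ^ 'n) topology" where
  "torus_power = pullback_topology unit_cubes vec_nth (product_topology (\<lambda>k. torus) UNIV)"

lemma topspace_torus_power: "topspace torus_power = unit_cubes"
  by (auto simp: torus_power_def topspace_pullback_topology topspace_torus unit_cubes_def)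

abbreviation torus_power_times :: "(((real ^ 'd) ^ 'n) \<times> (real ^ 'm)) topology" where
  "torus_power_times \<equiv> prod_topology torus_power euclidean"

definition multiscale_map ::
  "('n \<Rightarrow> real \<Rightarrow> real) \<Rightarrow> (nat \<Rightarrow> real) \<Rightarrow> (nat \<Rightarrow> (real ^ 'd) \<Rightarrow> (real ^ 'm))
    \<Rightarrow> nat \<Rightarrow> (real ^ 'd) \<Rightarrow> ((real ^ 'd) ^ 'n) \<times> (real ^ 'm)" where
  "multiscale_map \<rho> \<epsilon> u h x = ((\<chi> k. frac_vec (x /\<^sub>R \<rho> k (\<epsilon> h))), u h x)"

definition bounded_in_Lp :: "'a::euclidean_space set \<Rightarrow> real \<Rightarrow> (nat \<Rightarrow> 'a \<Rightarrow> 'b::euclidean_space) \<Rightarrow> bool"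
  where
  "bounded_in_Lp D p u \<longleftrightarrow>
     (\<forall>h. u h \<in> borel_measurable (lebesgue_on D)) \<and>
     (\<exists>C::real. \<forall>h. (\<integral>\<^sup>+ x. ennreal (norm (u h x) powr p) \<partial>lebesgue_on D) \<le> ennreal C)"

definition admissible_integrand ::
  "(real ^ 'd) set \<Rightarrow> ((real ^ 'd) \<times> ((real ^ 'd) ^ 'n) \<times> (real ^ 'm) \<Rightarrow> real) \<Rightarrow> bool" where
  "admissible_integrand \<Omega> f \<longleftrightarrow>
     (\<forall>p \<in> \<Omega> \<times> unit_cubes \<times> UNIV. 0 \<le> f p) \<and>
     (\<forall>\<delta>>0. \<exists>X Y. compact X \<and> X \<subseteq> \<Omega> \<and> emeasure lebesgue (\<Omega> - X) \<le> ennreal \<delta> \<and>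
        compact Y \<and> Y \<subseteq> unit_cube \<and> emeasure lebesgue (unit_cube - Y) \<le> ennreal \<delta> \<and>
        continuous_on (X \<times> {y. \<forall>k. y $ k \<in> Y} \<times> UNIV) f)"


section \<open>Young measures\<close>

text \<open>The target space is a topology rather than a type, so that it can be \<^term>\<open>torus_power_times\<close>
  as well as a Euclidean space. Functions on it matter only on its \<^term>\<open>topspace\<close>.\<close>

definition borel_of :: "'s topology \<Rightarrow> 's measure" where
  "borel_of S = sigma (topspace S) {U. openin S U}"

definition radon_measure :: "'s topology \<Rightarrow> 's measure \<Rightarrow> bool" where
  "radon_measure S M \<longleftrightarrow>
     sets M = sets (borel_of S) \<and>
     (\<forall>K. compactin S K \<longrightarrow> emeasure M K < \<infinity>) \<and>
     (\<forall>B \<in> sets M. emeasure M B = (SUP K \<in> {K. compactin S K \<and> K \<subseteq> B}. emeasure M K))"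

definition C0 :: "'s topology \<Rightarrow> ('s \<Rightarrow> real) set" where
  "C0 S = {\<phi>. continuous_map S euclideanreal \<phi> \<and>
     (\<forall>e>0. \<exists>K. compactin S K \<and> (\<forall>s \<in> topspace S - K. \<bar>\<phi> s\<bar> < e))}"

definition sup_norm :: "'s topology \<Rightarrow> ('s \<Rightarrow> real) \<Rightarrow> real" where
  "sup_norm S \<phi> = (SUP s \<in> topspace S. \<bar>\<phi> s\<bar>)"

text \<open>Bochner integrable maps into \<^term>\<open>C0 S\<close> with the sup norm: a.e. limits of simple maps
  (strong measurability), with integrable norm.\<close>

definition L1_C0 :: "'a::euclidean_space set \<Rightarrow> 's topology \<Rightarrow> ('a \<Rightarrow> 's \<Rightarrow> real) set" where
  "L1_C0 D S = {\<phi>. (\<forall>x \<in> D. \<phi> x \<in> C0 S) \<and>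
     (\<exists>\<sigma> :: nat \<Rightarrow> 'a \<Rightarrow> 's \<Rightarrow> real.
        (\<forall>j. simple_function (lebesgue_on D) (\<sigma> j) \<and> (\<forall>x \<in> D. \<sigma> j x \<in> C0 S)) \<and>
        (AE x in lebesgue_on D. (\<lambda>j. sup_norm S (\<lambda>s. \<sigma> j x s - \<phi> x s)) \<longlonglongrightarrow> 0)) \<and>
     integrable (lebesgue_on D) (\<lambda>x. sup_norm S (\<phi> x))}"

text \<open>Elements are representatives of the a.e.-equivalence classes.\<close>

definition young_measures :: "'a::euclidean_space set \<Rightarrow> 's topology \<Rightarrow> ('a \<Rightarrow> 's measure) set" where
  "young_measures D S = {\<mu>.
     (\<forall>x \<in> D. radon_measure S (\<mu> x)) \<and>
     (AE x in lebesgue_on D. prob_space (\<mu> x)) \<and>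
     (\<forall>\<phi> \<in> C0 S. (\<lambda>x. \<integral>s. \<phi> s \<partial>\<mu> x) \<in> borel_measurable (lebesgue_on D))}"

definition generates_young_measure ::
  "'a::euclidean_space set \<Rightarrow> 's topology \<Rightarrow> (nat \<Rightarrow> 'a \<Rightarrow> 's) \<Rightarrow> ('a \<Rightarrow> 's measure) \<Rightarrow> bool" where
  "generates_young_measure D S w \<mu> \<longleftrightarrow>
     (\<forall>h. w h \<in> lebesgue_on D \<rightarrow>\<^sub>M borel_of S) \<and>
     \<mu> \<in> young_measures D S \<and>
     (\<forall>\<phi> \<in> L1_C0 D S.
        (\<lambda>h. \<integral>x. \<phi> x (w h x) \<partial>lebesgue_on D)
          \<longlonglongrightarrow> (\<integral>x. (\<integral>s. \<phi> x s \<partial>\<mu> x) \<partial>lebesgue_on D))"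

definition generates_multiscale_young_measure ::
  "(real ^ 'd) set \<Rightarrow> ('n \<Rightarrow> real \<Rightarrow> real) \<Rightarrow> (nat \<Rightarrow> real) \<Rightarrow> (nat \<Rightarrow> (real ^ 'd) \<Rightarrow> (real ^ 'm))
    \<Rightarrow> ((real ^ 'd) \<times> ((real ^ 'd) ^ 'n) \<Rightarrow> (real ^ 'm) measure) \<Rightarrow> bool" where
  "generates_multiscale_young_measure \<Omega> \<rho> \<epsilon> u \<nu> \<longleftrightarrow>
     bounded_in_Lp \<Omega> 1 u \<and>
     \<nu> \<in> young_measures (\<Omega> \<times> unit_cubes) euclidean \<and>
     (\<exists>\<mu>. generates_young_measure \<Omega> torus_power_times (multiscale_map \<rho> \<epsilon> u) \<mu> \<and>
        (\<forall>g :: (real ^ 'd) \<times> ((real ^ 'd) ^ 'n) \<times> (real ^ 'm) \<Rightarrow> ennreal.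
           g \<in> borel_measurable (lebesgue_on \<Omega> \<Otimes>\<^sub>M borel_of torus_power_times) \<longrightarrow>
           (\<integral>\<^sup>+ x. (\<integral>\<^sup>+ (y, z). g (x, y, z) \<partial>\<mu> x) \<partial>lebesgue_on \<Omega>) =
           (\<integral>\<^sup>+ (x, y). (\<integral>\<^sup>+ z. g (x, y, z) \<partial>\<nu> (x, y)) \<partial>lebesgue_on (\<Omega> \<times> unit_cubes))))"

end

theory Submission
  imports Defs
begin

text \<open>Truncate \<open>f\<close> in \<open>z\<close> by a cutoff \<open>\<theta>\<close> of radius \<open>R\<close>; by the growth condition \<open>\<theta> f \<le> M\<close> with \<open>M\<close>
  depending only on \<open>R\<close>. For a small \<open>\<delta>\<close>, uniform continuity on \<open>X \<times> Y\<^sup>n \<times> cball 0 R\<close> and Tietze extension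
  give \<open>F(x, \<cdot>)\<close>, finitely valued in \<open>x\<close> with values in \<open>C\<^sub>0(T\<^sup>n \<times> \<real>\<^sup>m)\<close>, with
  \<open>0 \<le> F \<le> M\<close> and \<open>|F - \<theta> f| \<le> e\<close> on \<open>X \<times> Y\<^sup>n \<times> \<real>\<^sup>m\<close>. Such an \<open>F\<close> is an admissible test function for the Young
  measure. It differs from \<open>\<theta> f\<close> by more than \<open>e\<close> only where \<open>x \<notin> X\<close> or some \<open>y\<^sup>k \<notin> Y\<close>. In the limit
  this set has measure \<open>O(\<delta>)\<close> by Fubini; along the sequence it has measure \<open>O(\<delta>)\<close> uniformly in the scale, because
  \<open>\<Omega>\<close> meets at most \<open>O(r\<^bsup>-d\<^esup>)\<close> cells of side \<open>r\<close>. Letting \<open>\<delta>, e \<rightarrow> 0\<close> and then \<open>R \<rightarrow> \<infinity>\<close> gives the claim.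
  The compositions \<open>f(x, w\<^sub>h(x))\<close> may fail to be measurable; their \<^const>\<open>nn_integral\<close> is then a lower integral.\<close>

section \<open>Measure of the unit cubes\<close>

lemma borel_measurable_vec_lambda [measurable]:
  "(vec_lambda :: ('n \<Rightarrow> 'a::euclidean_space) \<Rightarrow> 'a ^ 'n) \<in> borel_measurable (\<Pi>\<^sub>M k\<in>UNIV. lborel)"
proof (rule borel_measurable_euclidean_space[THEN iffD2], rule ballI)
  fix b :: "'a ^ 'n" assume "b \<in> Basis"
  then obtain k v where b: "b = axis k v" by (auto simp: Basis_vec_def)
  show "(\<lambda>w. vec_lambda w \<bullet> b) \<in> borel_measurable (\<Pi>\<^sub>M k\<in>UNIV. lborel)"
    unfolding b inner_axis vec_lambda_beta by measurable
qed

text \<open>Lebesgue measure is characterised by its values on boxes, and a box of vectors is the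
  product of its component boxes because every basis vector has the form \<open>axis k v\<close>.
  This makes product sets of vectors accessible to \<open>emeasure_PiM\<close>.\<close>

lemma lborel_vec_eq_distr_PiM:
  "(lborel :: (('a::euclidean_space) ^ 'n) measure) = distr (\<Pi>\<^sub>M k\<in>UNIV. lborel) borel vec_lambda"
proof (rule lborel_eqI)
  interpret product_sigma_finite "\<lambda>k::'n. lborel :: 'a measure" ..
  fix l u :: "'a ^ 'n" assume lu: "\<And>b. b \<in> Basis \<Longrightarrow> l \<bullet> b \<le> u \<bullet> b"
  have lu': "l $ k \<bullet> v \<le> u $ k \<bullet> v" if "v \<in> Basis" for k v
    using lu[of "axis k v"] that by (auto simp: Basis_vec_def inner_axis)
  have *: "vec_lambda -` box l u \<inter> space (\<Pi>\<^sub>M k\<in>UNIV. lborel) = PiE UNIV (\<lambda>k. box (l $ k) (u $ k))"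
    by (auto simp: mem_box Basis_vec_def inner_axis space_PiM PiE_def Pi_iff)
  have "emeasure (distr (\<Pi>\<^sub>M k\<in>UNIV. lborel) borel vec_lambda) (box l u)
     = (\<Prod>k\<in>UNIV. emeasure lborel (box (l $ k) (u $ k)))"
    by (subst emeasure_distr) (simp_all add: * emeasure_PiM)
  also have "\<dots> = ennreal (\<Prod>k\<in>UNIV. \<Prod>v\<in>Basis. (u - l) $ k \<bullet> v)"
    by (simp add: lu' prod_ennreal prod_nonneg inner_diff_left)
  \<comment> \<open>The vectors \<open>axis k v\<close> run exactly once through the basis, so the
    double product becomes the single one that \<open>lborel_eqI\<close> asks for.\<close>
  also have "(\<Prod>k\<in>UNIV. \<Prod>v\<in>Basis. (u - l) $ k \<bullet> v) = (\<Prod>(k, v)\<in>UNIV \<times> Basis. (u - l) \<bullet> axis k v)"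
    by (simp add: prod.cartesian_product inner_axis)
  also have "\<dots> = (\<Prod>b\<in>Basis. (u - l) \<bullet> b)"
    by (rule prod.reindex_cong[of "\<lambda>(k, v). axis k v", symmetric])
       (auto simp: inj_on_def Basis_vec_def axis_eq_axis)
  finally show "emeasure (distr (\<Pi>\<^sub>M k\<in>UNIV. lborel) borel vec_lambda) (box l u)
    = (\<Prod>b\<in>Basis. (u - l) \<bullet> b)" .
qed simp

lemma unit_cube_borel [measurable]: "unit_cube \<in> sets borel"
  unfolding unit_cube_def by measurable

lemma unit_cubes_borel [measurable]: "unit_cubes \<in> sets borel"
proof -
  have "unit_cubes = (\<Inter>k. (\<lambda>y. y $ k) -` unit_cube \<inter> space borel)"
    by (auto simp: unit_cubes_def)
  also have "\<dots> \<in> sets borel"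
    by (intro sets.countable_INT' measurable_sets[OF _ unit_cube_borel]
        borel_measurable_continuous_onI continuous_intros image_subsetI) auto
  finally show ?thesis .
qed

lemma emeasure_unit_cube: "emeasure lborel (unit_cube :: (real ^ 'd) set) = 1"
proof (rule antisym)
  let ?a = "0 :: real ^ 'd" and ?b = "1 :: real ^ 'd"
  have le: "\<And>v. v \<in> Basis \<Longrightarrow> ?a \<bullet> v \<le> ?b \<bullet> v" and one: "(\<Prod>v\<in>Basis. (?b - ?a) \<bullet> v) = 1"
    by (auto simp: Basis_vec_def inner_axis intro!: prod.neutral)
  have sub: "box ?a ?b \<subseteq> unit_cube" "unit_cube \<subseteq> cbox ?a ?b"
    by (auto simp: unit_cube_def mem_box_cart less_imp_le)
  show "emeasure lborel (unit_cube :: (real ^ 'd) set) \<le> 1"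
    using emeasure_mono[OF sub(2), of lborel] emeasure_lborel_cbox[OF le] one by simp
  show "1 \<le> emeasure lborel (unit_cube :: (real ^ 'd) set)"
    using emeasure_mono[OF sub(1), of lborel] emeasure_lborel_box[OF le] one by simp
qed

text \<open>The cylinder is a product with factor \<open>Z\<close> at \<open>k\<close> and the unit
  cube, of measure 1, at every other index.\<close>

lemma emeasure_unit_cubes_cylinder:
  fixes Z :: "(real ^ 'd) set"
  assumes [measurable]: "Z \<in> sets borel" and "Z \<subseteq> unit_cube"
  shows "emeasure lborel {y \<in> unit_cubes :: ((real ^ 'd) ^ 'n) set. y $ k \<in> Z} = emeasure lborel Z"
proof -
  interpret product_sigma_finite "\<lambda>k::'n. lborel :: (real ^ 'd) measure" ..
  let ?A = "{y \<in> unit_cubes :: ((real ^ 'd) ^ 'n) set. y $ k \<in> Z}"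
  let ?B = "\<lambda>j. if j = k then Z else unit_cube"
  have [measurable]: "?A \<in> sets borel" 
  proof -
    have "?A = unit_cubes \<inter> ((\<lambda>y. y $ k) -` Z \<inter> space borel)" by auto
    also have "\<dots> \<in> sets borel"
      by (intro sets.Int unit_cubes_borel measurable_sets[OF _ assms(1)] borel_measurable_continuous_onI continuous_intros)
    finally show ?thesis .
  qed
  have "emeasure lborel ?A = emeasure (distr (\<Pi>\<^sub>M k\<in>UNIV. lborel) borel vec_lambda) ?A"
    by (simp add: lborel_vec_eq_distr_PiM)
  also have "\<dots> = emeasure (\<Pi>\<^sub>M k\<in>UNIV. lborel) (vec_lambda -` ?A \<inter> space (\<Pi>\<^sub>M k\<in>UNIV. lborel))"
    by (rule emeasure_distr) simp_all
  also have "vec_lambda -` ?A \<inter> space (\<Pi>\<^sub>M k\<in>UNIV. lborel) = PiE UNIV ?B"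
    using assms(2) by (auto simp: space_PiM PiE_def Pi_def unit_cubes_def split: if_splits)
  also have "emeasure (\<Pi>\<^sub>M k\<in>UNIV. lborel) (PiE UNIV ?B) = (\<Prod>j\<in>UNIV. emeasure lborel (?B j))"
    by (rule emeasure_PiM) auto
  also have "\<dots> = (\<Prod>j\<in>UNIV. if j = k then emeasure lborel Z else 1)"
    by (rule prod.cong) (auto simp: emeasure_unit_cube)
  also have "\<dots> = emeasure lborel Z" by simp
  finally show ?thesis .
qed

lemma emeasure_unit_cubes: "emeasure lborel (unit_cubes :: ((real ^ 'd) ^ 'n) set) = 1"
proof -
  \<comment> \<open>\<open>undefined\<close> stands for an arbitrary index; the cylinder over the
    whole cube is no restriction.\<close>
  have "{y \<in> unit_cubes :: ((real ^ 'd) ^ 'n) set. y $ undefined \<in> unit_cube} = unit_cubes"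
    by (auto simp: unit_cubes_def)
  then show ?thesis
    using emeasure_unit_cubes_cylinder[of "unit_cube :: (real ^ 'd) set" "undefined :: 'n"] emeasure_unit_cube by simp
qed

section \<open>Measure of the exceptional sets\<close>

lemma frac_vec_borel [measurable]: "frac_vec \<in> borel_measurable borel"
proof (rule borel_measurable_euclidean_space[THEN iffD2], rule ballI)
  fix b :: "real ^ 'd" assume "b \<in> Basis"
  then obtain i where b: "b = axis i 1" by (auto simp: Basis_vec_def)
  show "(\<lambda>x. frac_vec x \<bullet> b) \<in> borel_measurable borel"
    unfolding b frac_vec_def inner_axis vec_lambda_beta frac_def by measurable
qed

text \<open>Union bound: a point leaves the good set either through \<open>x\<close> or through one
  of the components of \<open>y\<close>, and each component contributes a cylinder.\<close>

lemma emeasure_Times_unit_cubes_Diff_le: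
  fixes \<Omega> X :: "(real ^ 'd) set" and Y :: "(real ^ 'e) set"
  assumes [measurable]: "\<Omega> \<in> sets borel" "X \<in> sets borel" "Y \<in> sets borel"
  shows "emeasure lborel (\<Omega> \<times> (unit_cubes :: ((real ^ 'e) ^ 'n) set) - X \<times> {y. \<forall>k. y $ k \<in> Y})
    \<le> emeasure lborel (\<Omega> - X) + of_nat CARD('n) * (emeasure lborel \<Omega> * emeasure lborel (unit_cube - Y))"
proof -
  let ?C = "\<lambda>k::'n. {y \<in> unit_cubes :: ((real ^ 'e) ^ 'n) set. y $ k \<in> unit_cube - Y}"
  have meas [measurable]: "?C k \<in> sets borel" for k
  proof -
    have "?C k = unit_cubes \<inter> ((\<lambda>y. y $ k) -` (unit_cube - Y) \<inter> space borel)" by auto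
    also have "\<dots> \<in> sets borel"
      by (intro sets.Int unit_cubes_borel measurable_sets[of _ borel borel] borel_measurable_continuous_onI
          continuous_intros sets.Diff assms unit_cube_borel)
    finally show ?thesis .
  qed
  have CT: "\<Omega> \<times> ?C k \<in> sets borel" for k
    by (rule borel_Times[OF assms(1) meas])
  have DT: "(\<Omega> - X) \<times> (unit_cubes :: ((real ^ 'e) ^ 'n) set) \<in> sets borel"
    by (intro borel_Times) measurable
  have prod: "emeasure lborel (A \<times> B) = emeasure lborel A * emeasure lborel B"
    if "A \<in> sets borel" "B \<in> sets borel" for A :: "(real ^ 'd) set" and B :: "((real ^ 'e) ^ 'n) set"
    using that lborel.emeasure_pair_measure_Times[of A lborel B] by (simp add: lborel_prod)
  have "emeasure lborel (\<Omega> \<times> (unit_cubes :: ((real ^ 'e) ^ 'n) set) - X \<times> {y. \<forall>k. y $ k \<in> Y})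
    \<le> emeasure lborel ((\<Omega> - X) \<times> unit_cubes \<union> (\<Union>k. \<Omega> \<times> ?C k))"
    by (rule emeasure_mono, force simp: unit_cubes_def)
       (unfold sets_lborel, intro sets.Un sets.finite_UN CT DT finite)
  also have "\<dots> \<le> emeasure lborel ((\<Omega> - X) \<times> (unit_cubes :: ((real ^ 'e) ^ 'n) set)) + emeasure lborel (\<Union>k. \<Omega> \<times> ?C k)"
    by (rule emeasure_subadditive) (unfold sets_lborel, (intro sets.finite_UN CT DT finite)+)
  also have "emeasure lborel (\<Union>k. \<Omega> \<times> ?C k) \<le> (\<Sum>k\<in>UNIV. emeasure lborel (\<Omega> \<times> ?C k))"
    by (intro emeasure_subadditive_finite finite) (unfold sets_lborel, use CT in blast)
  also have "(\<Sum>k\<in>UNIV. emeasure lborel (\<Omega> \<times> ?C k)) 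
      = of_nat CARD('n) * (emeasure lborel \<Omega> * emeasure lborel (unit_cube - Y))"
  proof -
    have "emeasure lborel (\<Omega> \<times> ?C k) = emeasure lborel \<Omega> * emeasure lborel (unit_cube - Y)" for k
      by (subst prod[OF assms(1) meas]) (subst emeasure_unit_cubes_cylinder, auto)
    then show ?thesis by (simp only: sum_constant)
  qed
  finally show ?thesis
    by (simp add: prod emeasure_unit_cubes add_left_mono)
qed

text \<open>The set is covered by the copies \<open>r (Z + v)\<close> of \<open>Z\<close>, with
  \<open>v\<close> an integer vector. Each has measure \<open>r^d\<close> times that of
  \<open>Z\<close>, and a region of size \<open>L\<close> needs only O(r^(-d)) of them, so the
  powers of \<open>r\<close> cancel and the bound is uniform in the scale.\<close>

lemma emeasure_vimage_frac_vec_le: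
  fixes \<Omega> Z :: "(real ^ 'd) set"
  assumes [measurable]: "\<Omega> \<in> sets borel" "Z \<in> sets borel"
    and L: "\<And>x i. x \<in> \<Omega> \<Longrightarrow> \<bar>x $ i\<bar> \<le> L" and "0 \<le> L" and r: "0 < r" "r \<le> 1"
  shows "emeasure lborel {x \<in> \<Omega>. frac_vec (x /\<^sub>R r) \<in> Z}
    \<le> ennreal ((2 * L + 5) ^ CARD('d)) * emeasure lborel Z"
proof -
  \<comment> \<open>\<open>N\<close> bounds the integer parts of \<open>x $ i / r\<close> on
    \<open>\<Omega>\<close> in absolute value, so \<open>V\<close> contains the index of every cell
    that \<open>\<Omega>\<close> meets.\<close>
  define N where "N = \<lceil>L / r\<rceil> + 1"
  define V where "V = (PiE UNIV (\<lambda>_. {-N..N}) :: ('d \<Rightarrow> int) set)"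
  let ?T = "\<lambda>v. (\<lambda>x. r *\<^sub>R x + r *\<^sub>R (\<chi> i. of_int (v i))) ` Z"
  have N: "0 \<le> N" "of_int N \<le> L / r + 2"
  proof -
    have "0 \<le> L / r" using assms(4) r by simp
    then show "0 \<le> N" "of_int N \<le> L / r + 2" unfolding N_def by linarith+
  qed
  have finV: "finite V" by (auto simp: V_def intro: finite_PiE)
  have cardV: "card V = nat (2 * N + 1) ^ CARD('d)"
    using N by (simp add: V_def card_PiE)
  \<comment> \<open>As a preimage the copy is visibly Borel; as an affine image it has a computable
    measure.\<close>
  have T: "?T v = (\<lambda>x. x /\<^sub>R r - (\<chi> i. of_int (v i))) -` Z \<inter> space borel" for v
    using r by (auto simp: image_iff algebra_simps intro!: bexI[of _ "_ /\<^sub>R r - _"])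
  have Tm: "?T v \<in> sets borel" for v
    unfolding T by (rule measurable_sets[OF _ assms(2)]) measurable
  have ET: "emeasure lborel (?T v) = ennreal (r ^ CARD('d)) * emeasure lborel Z" for v
  proof -
    have "emeasure lborel (?T v) = emeasure lebesgue (?T v)"
      using Tm[of v] by simp
    also have "\<dots> = ennreal (r ^ CARD('d)) * emeasure lborel Z"
      using r emeasure_lebesgue_affine[of r "r *\<^sub>R (\<chi> i. of_int (v i))" Z] by (simp add: ennreal_power)
    finally show ?thesis .
  qed
  have "{x \<in> \<Omega>. frac_vec (x /\<^sub>R r) \<in> Z} \<subseteq> (\<Union>v\<in>V. ?T v)"
  proof
    fix x assume x: "x \<in> {x \<in> \<Omega>. frac_vec (x /\<^sub>R r) \<in> Z}"
    let ?v = "\<lambda>i. \<lfloor>x $ i / r\<rfloor>"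
    have "?v i \<in> {-N..N}" for i
    proof -
      have "\<bar>x $ i / r\<bar> \<le> L / r" using L[of x i] x r by (simp add: divide_right_mono)
      then show ?thesis unfolding N_def atLeastAtMost_iff by linarith
    qed
    then have v: "?v \<in> V" by (auto simp: V_def)
    have "x /\<^sub>R r - (\<chi> i. of_int (?v i)) = frac_vec (x /\<^sub>R r)"
      by (simp add: vec_eq_iff frac_vec_def frac_def field_simps)
    then have "x \<in> ?T ?v" unfolding T using x by simp
    with v show "x \<in> (\<Union>v\<in>V. ?T v)" by blast
  qed
  then have "emeasure lborel {x \<in> \<Omega>. frac_vec (x /\<^sub>R r) \<in> Z} \<le> emeasure lborel (\<Union>v\<in>V. ?T v)"
    by (rule emeasure_mono) (use Tm finV in auto)
  also have "\<dots> \<le> (\<Sum>v\<in>V. emeasure lborel (?T v))"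
    by (rule emeasure_subadditive_finite) (use finV Tm in auto)
  also have "\<dots> = ennreal (real (card V) * r ^ CARD('d)) * emeasure lborel Z"
    using r by (simp add: ET ennreal_mult ennreal_of_nat_eq_real_of_nat mult.assoc)
  \<comment> \<open>Each coordinate direction has \<open>2 N + 1\<close> cells of side
    \<open>r\<close>, of total length at most \<open>(2 (L / r + 2) + 1) r = 2 L + 5 r\<close>; with
    \<open>r \<le> 1\<close> this gives the constant.\<close>
  also have "real (card V) * r ^ CARD('d) = ((2 * of_int N + 1) * r) ^ CARD('d)"
    using N by (simp add: cardV power_mult_distrib)
  also have "ennreal \<dots> * emeasure lborel Z \<le> ennreal ((2 * L + 5) ^ CARD('d)) * emeasure lborel Z"
  proof (intro mult_right_mono ennreal_leI power_mono)
    have "(2 * of_int N + 1) * r \<le> (2 * (L / r + 2) + 1) * r"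
      using N r by (intro mult_right_mono) auto
    also have "\<dots> = 2 * L + 5 * r" using r by (simp add: field_simps)
    finally show "(2 * of_int N + 1) * r \<le> 2 * L + 5" using r by simp
  qed (use N r in auto)
  finally show ?thesis .
qed

section \<open>Young measures\<close>

lemma borel_of_euclidean: "borel_of euclidean = borel"
  by (simp add: borel_of_def borel_def)

lemma sets_borel_of: "sets (borel_of S) = sigma_sets (topspace S) {U. openin S U}"
  and space_borel_of: "space (borel_of S) = topspace S"
  by (auto simp: borel_of_def sets_measure_of_conv space_measure_of_conv dest: openin_subset)

lemma borel_measurable_borel_of:
  assumes "continuous_map S euclideanreal \<phi>"
  shows "\<phi> \<in> borel_measurable (borel_of S)"
proof (rule borel_measurableI)
  fix U :: "real set" assume "open U"
  then have "openin S {s \<in> topspace S. \<phi> s \<in> U}"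
    using assms by (simp add: continuous_map_def)
  then show "\<phi> -` U \<inter> space (borel_of S) \<in> sets (borel_of S)"
    by (auto simp: sets_borel_of space_borel_of vimage_def Int_def conj_commute intro: sigma_sets.Basic)
qed

text \<open>A finitely valued map into \<open>C0 S\<close> is an admissible test function. Its
  values lie between 0 and \<open>M\<close> and \<open>D\<close> has finite measure, so the
  convergence of Bochner integrals carries over to nonnegative integrals, where the later estimates
  take place.\<close>

lemma generates_young_measure_simple:
  fixes D :: "'a::euclidean_space set" and \<kappa> :: "'a \<Rightarrow> nat" and \<phi> :: "nat \<Rightarrow> 's \<Rightarrow> real"
  assumes gen: "generates_young_measure D S w \<mu>"
    and D: "D \<in> sets lebesgue" "emeasure lebesgue D < \<infinity>"
    and S: "topspace S \<noteq> {}"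
    and \<kappa>: "simple_function (lebesgue_on D) \<kappa>"
    and \<phi>: "\<And>i. \<phi> i \<in> C0 S" "\<And>i s. s \<in> topspace S \<Longrightarrow> 0 \<le> \<phi> i s" "\<And>i s. s \<in> topspace S \<Longrightarrow> \<phi> i s \<le> M"
  shows "(\<lambda>h. \<integral>\<^sup>+ x. ennreal (\<phi> (\<kappa> x) (w h x)) \<partial>lebesgue_on D)
    \<longlonglongrightarrow> (\<integral>\<^sup>+ x. (\<integral>\<^sup>+ s. ennreal (\<phi> (\<kappa> x) s) \<partial>\<mu> x) \<partial>lebesgue_on D)"
proof -
  let ?L = "lebesgue_on D"
  interpret finite_measure ?L
    using D by (intro finite_measureI) (simp add: emeasure_restrict_space)
  have M0: "0 \<le> M" using S \<phi>(2,3) by (meson ex_in_conv order_trans)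
  have [measurable]: "\<kappa> \<in> measurable ?L (count_space UNIV)"
    using \<kappa> by (rule measurable_simple_function)
  have \<phi>m [measurable]: "\<phi> i \<in> borel_measurable (borel_of S)" for i
    using \<phi>(1) by (intro borel_measurable_borel_of) (auto simp: C0_def)
  have wm [measurable]: "w h \<in> measurable ?L (borel_of S)" for h
    using gen by (simp add: generates_young_measure_def)
  have wS: "w h x \<in> topspace S" if "x \<in> D" for h x
    using measurable_space[OF wm, of x h] that by (simp add: space_borel_of)
  have young: "\<mu> \<in> young_measures D S"
    using gen by (simp add: generates_young_measure_def)
  then have \<mu>sets: "sets (\<mu> x) = sets (borel_of S)" if "x \<in> D" for x
    using that by (auto simp: young_measures_def radon_measure_def)
  have \<mu>prob: "AE x in ?L. prob_space (\<mu> x)"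
    using young by (simp add: young_measures_def)
  have [measurable]: "(\<lambda>x. \<integral>s. \<phi> i s \<partial>\<mu> x) \<in> borel_measurable ?L" for i
    using young \<phi>(1) by (simp add: young_measures_def)
  have intm [measurable]: "(\<lambda>x. \<integral>s. \<phi> (\<kappa> x) s \<partial>\<mu> x) \<in> borel_measurable ?L"
    by (rule measurable_compose_countable[of "\<lambda>i x. \<integral>s. \<phi> i s \<partial>\<mu> x"]) measurable
  have compm [measurable]: "(\<lambda>x. \<phi> (\<kappa> x) (w h x)) \<in> borel_measurable ?L" for h
    by (rule measurable_compose_countable[of "\<lambda>i x. \<phi> i (w h x)"]) measurable
  have inner: "AE x in ?L. (\<integral>\<^sup>+ s. ennreal (\<phi> (\<kappa> x) s) \<partial>\<mu> x) = ennreal (\<integral>s. \<phi> (\<kappa> x) s \<partial>\<mu> x)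
      \<and> 0 \<le> (\<integral>s. \<phi> (\<kappa> x) s \<partial>\<mu> x) \<and> (\<integral>s. \<phi> (\<kappa> x) s \<partial>\<mu> x) \<le> M"
    using \<mu>prob AE_space
  proof eventually_elim
    case (elim x)
    then have x: "x \<in> D" by simp
    interpret p: prob_space "\<mu> x" by fact
    have sp: "space (\<mu> x) = topspace S"
      using sets_eq_imp_space_eq[OF \<mu>sets[OF x]] by (simp add: space_borel_of)
    have meas: "\<phi> i \<in> borel_measurable (\<mu> x)" for i
      using \<phi>m[of i] by (simp cong: measurable_cong_sets add: \<mu>sets[OF x])
    have int: "integrable (\<mu> x) (\<phi> i)" for i
      by (rule p.integrable_const_bound[where B = M]) (use meas \<phi> sp in auto)
    have "(\<integral>s. \<phi> (\<kappa> x) s \<partial>\<mu> x) \<le> (\<integral>s. M \<partial>\<mu> x)"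
      by (rule integral_mono) (use int \<phi> sp in auto)
    moreover have "0 \<le> (\<integral>s. \<phi> (\<kappa> x) s \<partial>\<mu> x)"
      by (rule integral_nonneg_AE) (use \<phi> sp in auto)
    moreover have "(\<integral>\<^sup>+ s. ennreal (\<phi> (\<kappa> x) s) \<partial>\<mu> x) = ennreal (\<integral>s. \<phi> (\<kappa> x) s \<partial>\<mu> x)"
      by (rule nn_integral_eq_integral) (use int \<phi> sp in auto)
    ultimately show ?case by (simp add: p.prob_space)
  qed
  \<comment> \<open>The map takes finitely many values, so the constant sequence of copies of itself
    witnesses strong measurability. Since the space is nonempty, the sup norm of the zero difference
    is a supremum over a nonempty set and equals 0.\<close>
  have L1: "(\<lambda>x. \<phi> (\<kappa> x)) \<in> L1_C0 D S"
    unfolding L1_C0_def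
  proof (intro CollectI conjI ballI exI[of _ "\<lambda>j x. \<phi> (\<kappa> x)"] allI)
    show "simple_function ?L (\<lambda>x. \<phi> (\<kappa> x))"
      using simple_function_compose[OF \<kappa>, of \<phi>] by (simp add: comp_def)
    have "sup_norm S (\<lambda>s. \<phi> (\<kappa> x) s - \<phi> (\<kappa> x) s) = 0" for x
      using S by (simp add: sup_norm_def)
    then show "AE x in ?L. (\<lambda>j. sup_norm S (\<lambda>s. \<phi> (\<kappa> x) s - \<phi> (\<kappa> x) s)) \<longlonglongrightarrow> 0"
      by simp
    have sf: "simple_function ?L (\<lambda>x. sup_norm S (\<phi> (\<kappa> x)))"
      using simple_function_compose[OF \<kappa>, of "\<lambda>i. sup_norm S (\<phi> i)"] by (simp add: comp_def)
    have fin: "finite ((\<lambda>x. \<bar>sup_norm S (\<phi> (\<kappa> x))\<bar>) ` D)"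
      using simple_functionD(1)[OF simple_function_compose[OF sf, of abs]] by (simp add: comp_def)
    \<comment> \<open>The norm has finitely many values, whose maximum is an integrable bound on a
      finite measure space.\<close>
    show "integrable ?L (\<lambda>x. sup_norm S (\<phi> (\<kappa> x)))"
      by (rule integrable_const_bound[where B = "Max ((\<lambda>x. \<bar>sup_norm S (\<phi> (\<kappa> x))\<bar>) ` D)"])
         (use fin borel_measurable_simple_function[OF sf] in auto)
  qed (use \<phi>(1) in auto)
  have lim: "(\<lambda>h. \<integral>x. \<phi> (\<kappa> x) (w h x) \<partial>?L) \<longlonglongrightarrow> (\<integral>x. (\<integral>s. \<phi> (\<kappa> x) s \<partial>\<mu> x) \<partial>?L)"
    using gen[unfolded generates_young_measure_def, THEN conjunct2, THEN conjunct2, THEN bspec, OF L1] .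
  have 1: "(\<integral>\<^sup>+ x. ennreal (\<phi> (\<kappa> x) (w h x)) \<partial>?L) = ennreal (\<integral>x. \<phi> (\<kappa> x) (w h x) \<partial>?L)" for h
    by (rule nn_integral_eq_integral[OF integrable_const_bound[where B = M]])
       (use wS \<phi> in auto)
  have "(\<integral>\<^sup>+ x. (\<integral>\<^sup>+ s. ennreal (\<phi> (\<kappa> x) s) \<partial>\<mu> x) \<partial>?L) = (\<integral>\<^sup>+ x. ennreal (\<integral>s. \<phi> (\<kappa> x) s \<partial>\<mu> x) \<partial>?L)"
    by (rule nn_integral_cong_AE) (use inner in auto)
  also have "\<dots> = ennreal (\<integral>x. (\<integral>s. \<phi> (\<kappa> x) s \<partial>\<mu> x) \<partial>?L)"
    by (rule nn_integral_eq_integral[OF integrable_const_bound[where B = M]])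
       (use inner in auto)
  finally show ?thesis
    using tendsto_ennrealI[OF lim] by (simp add: 1)
qed

section \<open>From weak* measurable families to probability kernels\<close>

text \<open>A cutoff of radius \<open>j\<close> makes the functions vanish at infinity, and the
  distance to the complement, multiplied by \<open>j\<close> and capped at 1, tends to the
  indicator.\<close>

lemma indicator_open_LIMSEQ_C0:
  fixes U :: "'a::euclidean_space set"
  assumes "open U"
  obtains \<phi> :: "nat \<Rightarrow> 'a \<Rightarrow> real"
  where "\<And>j. \<phi> j \<in> C0 euclidean" "\<And>j z. 0 \<le> \<phi> j z" "\<And>j z. \<phi> j z \<le> 1"
    "\<And>z. (\<lambda>j. \<phi> j z) \<longlonglongrightarrow> indicator U z"
proof (cases "U = UNIV")
  \<comment> \<open>\<open>infdist\<close> to the empty set is 0, so the distance factor would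
    vanish identically here; the cutoff alone suffices.\<close>
  case True
  let ?\<phi> = "\<lambda>j z::'a. max 0 (min 1 (real j - norm z))"
  show ?thesis
  proof (rule that[of ?\<phi>])
    fix j show "?\<phi> j \<in> C0 euclidean"
      unfolding C0_def
      by (auto intro!: continuous_intros exI[of _ "cball 0 (real j)"])
  next
    fix z :: 'a
    have "\<forall>\<^sub>F j in sequentially. ?\<phi> j z = 1"
      using eventually_ge_at_top[of "nat \<lceil>norm z + 1\<rceil>"] by eventually_elim linarith
    then show "(\<lambda>j. ?\<phi> j z) \<longlonglongrightarrow> indicator U z"
      by (simp add: True tendsto_eventually)
  qed auto
next
  case False
  let ?d = "\<lambda>z. infdist z (- U)"
  let ?\<phi> = "\<lambda>j z::'a. max 0 (min 1 (real j - norm z)) * min 1 (real j * ?d z)"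
  show ?thesis
  proof (rule that[of ?\<phi>])
    fix j show "?\<phi> j \<in> C0 euclidean"
      unfolding C0_def
      by (auto intro!: continuous_intros exI[of _ "cball 0 (real j)"])
  next
    fix j z show "?\<phi> j z \<le> 1" 
      by (intro mult_le_one) (auto simp: infdist_nonneg)
  next
    fix z :: 'a
    have 1: "\<forall>\<^sub>F j in sequentially. max 0 (min 1 (real j - norm z)) = 1"
      using eventually_ge_at_top[of "nat \<lceil>norm z + 1\<rceil>"] by eventually_elim linarith
    have "\<forall>\<^sub>F j in sequentially. ?\<phi> j z = indicator U z"
    proof (cases "z \<in> U")
      case True
      have "closed (- U)" "- U \<noteq> {}" using assms False by auto
      then have d: "0 < ?d z"
        using in_closed_iff_infdist_zero[of "- U" z] True infdist_nonneg[of z "- U"] by auto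
      have "\<forall>\<^sub>F j in sequentially. 1 \<le> real j * ?d z"
        using eventually_ge_at_top[of "nat \<lceil>1 / ?d z\<rceil>"]
        by eventually_elim (use d in \<open>simp add: divide_simps nat_le_iff ceiling_le_iff\<close>)
      with 1 show ?thesis by eventually_elim (simp add: True)
    qed simp
    then show "(\<lambda>j. ?\<phi> j z) \<longlonglongrightarrow> indicator U z"
      by (simp add: tendsto_eventually)
  qed (auto simp: infdist_nonneg)
qed

text \<open>Weak* measurability only tests against \<open>C0\<close>, while inner integrals of
  jointly measurable functions require a kernel. Approximating indicators of open sets from
  \<open>C0\<close> gives measurability of the mass of each open set by dominated convergence, and
  the open sets are an intersection-stable generator.\<close>

lemma young_measure_AE_eq_kernel:
  fixes \<nu> :: "'a::euclidean_space \<Rightarrow> 'b::euclidean_space measure"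
  assumes "\<nu> \<in> young_measures D euclidean" and D: "D \<in> sets lebesgue"
  obtains \<nu>' where "\<nu>' \<in> measurable (lebesgue_on D) (prob_algebra borel)"
    "AE x in lebesgue_on D. \<nu>' x = \<nu> x"
proof -
  let ?L = "lebesgue_on D"
  have sets\<nu>: "sets (\<nu> x) = sets borel" if "x \<in> D" for x
    using assms(1) that by (auto simp: young_measures_def radon_measure_def borel_of_euclidean)
  have wm: "(\<lambda>x. \<integral>s. \<phi> s \<partial>\<nu> x) \<in> borel_measurable ?L" if "\<phi> \<in> C0 euclidean" for \<phi>
    using assms(1) that by (simp add: young_measures_def)
  have "AE x in ?L. prob_space (\<nu> x)"
    using assms(1) by (simp add: young_measures_def)
  then obtain N where N: "\<And>x. x \<in> space ?L - N \<Longrightarrow> prob_space (\<nu> x)" "N \<in> null_sets ?L"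
    by (rule AE_E3) blast
  then have [measurable]: "N \<in> sets ?L" by auto
  \<comment> \<open>A Dirac mass on the null set makes every value a probability measure, not just
    almost every one.\<close>
  define \<nu>' where "\<nu>' x = (if x \<in> N then return borel 0 else \<nu> x)" for x
  have prob: "prob_space (\<nu>' x)" if "x \<in> D" for x
    using N that by (auto simp: \<nu>'_def prob_space_return)
  have sets\<nu>': "sets (\<nu>' x) = sets borel" if "x \<in> D" for x
    using sets\<nu> that by (simp add: \<nu>'_def)
  have "\<nu>' \<in> measurable ?L (prob_algebra borel)"
  proof (rule measurable_prob_algebra_generated[of borel UNIV "{U. open U}"])
    fix U :: "'b set" assume "U \<in> {U. open U}"
    then have "open U" by simp
    then obtain \<phi> :: "nat \<Rightarrow> 'b \<Rightarrow> real" where \<phi>: "\<And>j. \<phi> j \<in> C0 euclidean" "\<And>j z. 0 \<le> \<phi> j z" "\<And>j z. \<phi> j z \<le> 1"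
      "\<And>z. (\<lambda>j. \<phi> j z) \<longlonglongrightarrow> indicator U z"
      using indicator_open_LIMSEQ_C0 by metis
    have \<phi>m: "\<phi> j \<in> borel_measurable borel" for j
      using borel_measurable_borel_of[of euclidean "\<phi> j"] \<phi>(1) by (auto simp: C0_def borel_of_euclidean)
    have "(\<lambda>x. measure (\<nu>' x) U) \<in> borel_measurable ?L"
    proof (rule borel_measurable_LIMSEQ_real)
      fix x assume "x \<in> space ?L"
      then have x: "x \<in> D" by simp
      interpret p: prob_space "\<nu>' x" by (rule prob[OF x])
      have "(\<lambda>j. \<integral>z. \<phi> j z \<partial>\<nu>' x) \<longlonglongrightarrow> (\<integral>z. indicator U z \<partial>\<nu>' x)"
        by (rule integral_dominated_convergence[where w = "\<lambda>_. 1"])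
           (use \<phi> \<phi>m \<open>open U\<close> in \<open>auto cong: measurable_cong_sets simp: sets\<nu>'[OF x]\<close>)
      then show "(\<lambda>j. \<integral>z. \<phi> j z \<partial>\<nu>' x) \<longlonglongrightarrow> measure (\<nu>' x) U"
        using sets_eq_imp_space_eq[OF sets\<nu>'[OF x]] by simp
    next
      fix j
      have "(\<lambda>x. if x \<in> N then \<integral>z. \<phi> j z \<partial>return borel 0 else \<integral>z. \<phi> j z \<partial>\<nu> x) \<in> borel_measurable ?L"
        using wm[OF \<phi>(1)[of j]] by measurable
      also have "(\<lambda>x. if x \<in> N then \<integral>z. \<phi> j z \<partial>return borel 0 else \<integral>z. \<phi> j z \<partial>\<nu> x) = (\<lambda>x. \<integral>z. \<phi> j z \<partial>\<nu>' x)"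
        by (auto simp: \<nu>'_def)
      finally show "(\<lambda>x. \<integral>z. \<phi> j z \<partial>\<nu>' x) \<in> borel_measurable ?L" .
    qed
    then have "(\<lambda>x. ennreal (measure (\<nu>' x) U)) \<in> borel_measurable ?L" by measurable
    also have "?this \<longleftrightarrow> (\<lambda>x. emeasure (\<nu>' x) U) \<in> borel_measurable ?L"
      by (rule measurable_cong) 
         (use prob in \<open>simp add: finite_measure.emeasure_eq_measure prob_space.axioms(1)\<close>)
    finally show "(\<lambda>x. emeasure (\<nu>' x) U) \<in> borel_measurable ?L" .
  qed (use prob sets\<nu>' in \<open>auto simp: borel_def Int_stable_def\<close>)
  moreover have "AE x in ?L. \<nu>' x = \<nu> x"
    using AE_not_in[OF N(2)] by eventually_elim (simp add: \<nu>'_def)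
  ultimately show ?thesis by (rule that)
qed

section \<open>Continuous functions on the torus\<close>

lemma continuous_map_euclidean_vec:
  assumes "\<And>k. continuous_map X euclidean (\<lambda>x. f x $ k)"
  shows "continuous_map X euclidean f"
  using assms by (auto simp: continuous_map_atin intro!: vec_tendstoI)

lemma bounded_vec_power:
  assumes "bounded (Y :: 'a::real_normed_vector set)"
  shows "bounded {y :: 'a ^ 'n. \<forall>k. y $ k \<in> Y}"
proof -
  obtain B where B: "\<And>y. y \<in> Y \<Longrightarrow> norm y \<le> B"
    using assms by (auto simp: bounded_iff)
  have "norm y \<le> (\<Sum>k\<in>(UNIV :: 'n set). B)" if "\<forall>k. y $ k \<in> Y" for y :: "'a ^ 'n"
  proof -
    have "norm y \<le> (\<Sum>k\<in>UNIV. norm (y $ k))"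
      unfolding norm_vec_def by (rule L2_set_le_sum) simp
    also have "\<dots> \<le> (\<Sum>k\<in>(UNIV :: 'n set). B)"
      using that B by (intro sum_mono) auto
    finally show ?thesis .
  qed
  then show ?thesis by (auto simp: bounded_iff)
qed

lemma compact_vec_power:
  assumes "compact (Y :: 'a::euclidean_space set)"
  shows "compact {y :: 'a ^ 'n. \<forall>k. y $ k \<in> Y}"
proof -
  have "closed {y :: 'a ^ 'n. y $ k \<in> Y}" for k
    using continuous_closed_vimage[OF compact_imp_closed[OF assms], of "\<lambda>y. y $ k"]
    by (simp add: vimage_def continuous_intros)
  then show ?thesis
    using bounded_vec_power[OF compact_imp_bounded[OF assms]]
    by (auto simp: compact_eq_bounded_closed intro: closed_Collect_all)
qed

lemma bounded_unit_cubes: "bounded (unit_cubes :: ((real ^ 'd) ^ 'n) set)"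
proof -
  have "bounded (unit_cube :: (real ^ 'd) set)"
    by (rule bounded_subset[OF bounded_vec_power[of "{0..1::real}"]])
       (auto simp: unit_cube_def less_imp_le)
  then show ?thesis
    unfolding unit_cubes_def by (rule bounded_vec_power)
qed

lemma frac_vec_of_unit_cube: "y \<in> unit_cube \<Longrightarrow> frac_vec y = y"
  by (simp add: unit_cube_def frac_vec_def vec_eq_iff frac_eq)

text \<open>The componentwise quotient map is continuous and sends the Euclidean closure of the
  cubes, which is compact, onto the cubes. Together with a cutoff in \<open>z\<close> this yields
  the compact sets that membership in \<open>C0\<close> requires.\<close>

lemma compactin_torus_power: "compactin torus_power (unit_cubes :: ((real ^ 'd) ^ 'n) set)"
proof -
  let ?\<pi> = "\<lambda>v :: (real ^ 'd) ^ 'n. \<chi> k. frac_vec (v $ k)"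
  have "continuous_map euclidean torus (frac_vec :: real ^ 'd \<Rightarrow> _)"
    by (auto simp: continuous_map_def topspace_torus frac_vec_in_unit_cube openin_torus vimage_def)
  then have "continuous_map euclidean torus (\<lambda>v :: (real ^ 'd) ^ 'n. frac_vec (v $ k))" for k
    using continuous_map_compose[of euclidean euclidean "\<lambda>v. v $ k" torus frac_vec]
    by (simp add: comp_def continuous_on_component)
  then have "continuous_map euclidean torus_power ?\<pi>"
    unfolding torus_power_def
    by (intro continuous_map_pullback')
       (auto simp: comp_def continuous_map_componentwise_UNIV unit_cubes_def frac_vec_in_unit_cube)
  moreover have "compactin euclidean (closure (unit_cubes :: ((real ^ 'd) ^ 'n) set))"
    by (simp add: bounded_unit_cubes)
  ultimately have "compactin torus_power (?\<pi> ` closure unit_cubes)"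
    by (rule image_compactin[rotated])
  moreover have "?\<pi> ` closure unit_cubes = unit_cubes"
  proof
    show "?\<pi> ` closure unit_cubes \<subseteq> unit_cubes"
      by (auto simp: unit_cubes_def frac_vec_in_unit_cube)
    show "unit_cubes \<subseteq> ?\<pi> ` closure unit_cubes"
    proof
      fix y :: "(real ^ 'd) ^ 'n" assume y: "y \<in> unit_cubes"
      then have "y = ?\<pi> y" by (simp add: unit_cubes_def vec_eq_iff frac_vec_of_unit_cube)
      then show "y \<in> ?\<pi> ` closure unit_cubes" using y closure_subset by blast
    qed
  qed
  ultimately show ?thesis by simp
qed

section \<open>Embedding and extension of functions on the torus\<close>

text \<open>The standard realisation of the torus as a product of unit circles, one for each real
  coordinate.\<close>

definition torus_embedding :: "(real ^ 'd) ^ 'n \<Rightarrow> (complex ^ 'd) ^ 'n" where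
  "torus_embedding y = (\<chi> k i. cis (2 * pi * y $ k $ i))"

lemma continuous_on_torus_embedding: "continuous_on S torus_embedding"
  unfolding torus_embedding_def by (intro continuous_on_vec_lambda continuous_intros)

text \<open>In the quotient topology continuity is tested after composing with
  \<open>frac_vec\<close>; since \<open>cis (2 * pi * t)\<close> is 1-periodic in \<open>t\<close>,
  the composition is the same formula on the whole space and is continuous there.\<close>

lemma continuous_map_torus_embedding:
  "continuous_map torus_power euclidean (torus_embedding :: (real ^ 'd) ^ 'n \<Rightarrow> _)"
proof (intro continuous_map_euclidean_vec)
  fix k :: 'n and i :: 'd
  let ?c = "\<lambda>t :: real ^ 'd. cis (2 * pi * t $ i)"
  have periodic: "?c (frac_vec x) = ?c x" for x
  proof -
    have "2 * pi * frac_vec x $ i = 2 * pi * x $ i - 2 * pi * of_int \<lfloor>x $ i\<rfloor>"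
      by (simp add: frac_vec_def frac_def algebra_simps)
    also have "cis \<dots> = ?c x"
      by (simp add: cis_divide[symmetric] cis_multiple_2pi)
    finally show ?thesis .
  qed
  have "continuous_map torus euclidean ?c"
    unfolding continuous_map_def openin_torus topspace_torus
  proof (intro conjI allI impI)
    fix U :: "complex set" assume "openin euclidean U"
    then have "open (?c -` U)"
      by (intro open_vimage continuous_intros) auto
    also have "?c -` U = frac_vec -` {t \<in> unit_cube. ?c t \<in> U}"
      by (auto simp: periodic frac_vec_in_unit_cube)
    finally show "open (frac_vec -` {t \<in> unit_cube. ?c t \<in> U})" .
  qed auto
  moreover have "continuous_map torus_power torus (\<lambda>y :: (real ^ 'd) ^ 'n. y $ k)"
    using continuous_map_pullback[OF continuous_map_product_projection[of k UNIV "\<lambda>k. torus"], of unit_cubes vec_nth]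
    by (simp add: torus_power_def comp_def)
  ultimately show "continuous_map torus_power euclidean (\<lambda>y :: (real ^ 'd) ^ 'n. torus_embedding y $ k $ i)"
    using continuous_map_compose[of torus_power torus "\<lambda>y. y $ k" euclidean ?c]
    by (simp add: comp_def torus_embedding_def)
qed

text \<open>Equal points on a circle have parameters differing by an integer, and two numbers in
  [0,1) can only differ by the integer 0.\<close>

lemma inj_on_torus_embedding: "inj_on torus_embedding unit_cubes"
proof (rule inj_onI)
  fix y y' :: "(real ^ 'd) ^ 'n"
  assume y: "y \<in> unit_cubes" "y' \<in> unit_cubes" and eq: "torus_embedding y = torus_embedding y'"
  have "y $ k $ i = y' $ k $ i" for k i
  proof -
    have "cis (2 * pi * y $ k $ i) = cis (2 * pi * y' $ k $ i)"
      using eq by (simp add: torus_embedding_def vec_eq_iff)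
    then obtain j :: int where "2 * pi * y $ k $ i = 2 * pi * y' $ k $ i + 2 * pi * j"
      using sin_cos_eq_iff by (metis cis.simps)
    then have j: "y $ k $ i = y' $ k $ i + j"
      by (simp flip: distrib_left)
    moreover have "0 \<le> y $ k $ i" "y $ k $ i < 1" "0 \<le> y' $ k $ i" "y' $ k $ i < 1"
      using y by (auto simp: unit_cubes_def unit_cube_def)
    ultimately have "j = 0" by linarith
    with j show ?thesis by simp
  qed
  then show "y = y'" by (simp add: vec_eq_iff)
qed

definition cutoff :: "real \<Rightarrow> 'a::real_normed_vector \<Rightarrow> real" where
  "cutoff R z = max 0 (min 1 (R - norm z))"

lemma cutoff_bounds: "0 \<le> cutoff R z" "cutoff R z \<le> 1"
  by (auto simp: cutoff_def)

lemma cutoff_eq_0: "R \<le> norm z \<Longrightarrow> cutoff R z = 0"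
  by (simp add: cutoff_def)

lemma cutoff_eq_1: "norm z + 1 \<le> R \<Longrightarrow> cutoff R z = 1"
  by (simp add: cutoff_def)

lemma cutoff_mono: "R \<le> R' \<Longrightarrow> cutoff R z \<le> cutoff R' z"
  by (simp add: cutoff_def max_def min_def)

lemma continuous_on_cutoff [continuous_intros]:
  "continuous_on S g \<Longrightarrow> continuous_on S (\<lambda>x. cutoff R (g x))"
  unfolding cutoff_def by (intro continuous_intros)

text \<open>A compact subset of the unit cube carries the same topology in the torus as in Euclidean
  space, since \<^const>\<open>torus_embedding\<close> is injective and continuous for both.\<close>

lemma C0_torus_power_times_extension:
  fixes Y :: "(real ^ 'd) set" and g :: "((real ^ 'd) ^ 'n) \<times> (real ^ 'm) \<Rightarrow> real"
  assumes Y: "compact Y" "Y \<subseteq> unit_cube"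
    and g: "continuous_on ({y. \<forall>k. y $ k \<in> Y} \<times> cball 0 R) g"
    and bounds: "\<And>y z. \<forall>k. y $ k \<in> Y \<Longrightarrow> norm z \<le> R \<Longrightarrow> 0 \<le> g (y, z) \<and> g (y, z) \<le> M"
    and "0 \<le> M"
  obtains \<phi> where "\<phi> \<in> C0 torus_power_times" "continuous_on UNIV \<phi>"
    "\<And>p. 0 \<le> \<phi> p" "\<And>p. \<phi> p \<le> M"
    "\<And>y z. \<forall>k. y $ k \<in> Y \<Longrightarrow> \<phi> (y, z) = cutoff R z * g (y, z)"
proof -
  define K where "K = {y :: (real ^ 'd) ^ 'n. \<forall>k. y $ k \<in> Y} \<times> cball (0 :: real ^ 'm) R"
  define E :: "((real ^ 'd) ^ 'n) \<times> (real ^ 'm) \<Rightarrow> _" where "E p = (torus_embedding (fst p), snd p)" for p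
  have K: "compact K"
    unfolding K_def by (intro compact_Times compact_vec_power Y compact_cball)
  have E: "continuous_on S E" for S
    unfolding E_def
    by (intro continuous_on_Pair continuous_on_snd continuous_on_id
        continuous_on_compose2[OF continuous_on_torus_embedding, of _ fst UNIV] continuous_on_fst) auto
  have "inj_on torus_embedding {y :: (real ^ 'd) ^ 'n. \<forall>k. y $ k \<in> Y}"
    by (rule inj_on_subset[OF inj_on_torus_embedding]) (use Y(2) in \<open>auto simp: unit_cubes_def\<close>)
  then have "inj_on E K"
    by (auto simp: E_def K_def intro!: inj_onI dest: inj_onD)
  then have inv: "the_inv_into K E (E p) = p" if "p \<in> K" for p
    using that by (rule the_inv_into_f_f)
  \<comment> \<open>A continuous injection on a compact set has a continuous inverse, so
    \<open>g\<close> can be transported to the compact image of \<open>K\<close>.\<close>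
  have "continuous_on (E ` K) (the_inv_into K E)"
    by (rule continuous_on_inv[OF E K]) (use inv in auto)
  then have gE: "continuous_on (E ` K) (g \<circ> the_inv_into K E)"
    by (rule continuous_on_compose) (use g inv in \<open>auto simp: K_def intro!: continuous_on_subset[OF g]\<close>)
  have cl: "closedin (top_of_set UNIV) (E ` K)"
    using compact_continuous_image[OF E K] by (simp add: compact_imp_closed)
  have nm: "norm ((g \<circ> the_inv_into K E) p) \<le> M" if "p \<in> E ` K" for p
    using that inv bounds by (auto simp: K_def)
  \<comment> \<open>Tietze is applied in the Euclidean space that contains the circles; pulling the
    extension back along \<open>E\<close> then gives continuity in the torus topology as well as in
    the Euclidean one.\<close>
  obtain G where G: "continuous_on UNIV G"
    "\<And>p. p \<in> E ` K \<Longrightarrow> G p = (g \<circ> the_inv_into K E) p" "\<And>p. norm (G p) \<le> M"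
    by (rule Tietze[OF gE cl \<open>0 \<le> M\<close> nm]) auto
  \<comment> \<open>The absolute value restores nonnegativity and changes nothing on
    \<open>E(K)\<close>, where \<open>g\<close> is nonnegative; the cutoff confines the support to
    \<open>norm z \<le> R\<close>.\<close>
  define \<phi> where "\<phi> p = cutoff R (snd p) * \<bar>G (E p)\<bar>" for p
  have "continuous_map torus_power_times euclidean (\<lambda>p. torus_embedding (fst p))"
    using continuous_map_compose[OF continuous_map_fst continuous_map_torus_embedding]
    by (simp add: comp_def)
  then have "continuous_map torus_power_times (prod_topology euclidean euclidean) E"
    unfolding E_def by (intro continuous_map_pairedI continuous_map_snd)
  then have "continuous_map torus_power_times euclideanreal (G \<circ> E)"
    using G(1) by (intro continuous_map_compose[where X'=euclidean]) auto
  moreover have "continuous_map torus_power_times euclideanreal (cutoff R \<circ> snd)"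
    by (rule continuous_map_compose[OF continuous_map_snd]) (simp add: continuous_intros)
  ultimately have "continuous_map torus_power_times euclideanreal \<phi>"
    unfolding \<phi>_def comp_def by (intro continuous_map_real_mult continuous_map_real_abs)
  moreover have "compactin torus_power_times (unit_cubes \<times> cball 0 R)"
    by (simp add: compactin_Times compactin_torus_power)
  moreover have "\<bar>\<phi> p\<bar> < e" if "0 < e" "p \<in> topspace torus_power_times - unit_cubes \<times> cball 0 R" for e p
  proof -
    have "R \<le> norm (snd p)"
      using that(2) by (cases p) (auto simp: topspace_torus_power)
    then show ?thesis using \<open>0 < e\<close> by (simp add: \<phi>_def cutoff_eq_0)
  qed
  ultimately have "\<phi> \<in> C0 torus_power_times"
    unfolding C0_def by blast
  moreover have "continuous_on UNIV \<phi>"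
    unfolding \<phi>_def by (intro continuous_intros continuous_on_compose2[OF G(1) E]) auto
  moreover have "0 \<le> \<phi> p" "\<phi> p \<le> M" for p
  proof -
    show "0 \<le> \<phi> p" by (simp add: \<phi>_def cutoff_bounds)
    have "\<phi> p \<le> 1 * M" unfolding \<phi>_def
      using G(3)[of "E p"] by (intro mult_mono) (auto simp: cutoff_bounds)
    then show "\<phi> p \<le> M" by simp
  qed
  moreover have "\<phi> (y, z) = cutoff R z * g (y, z)" if "\<forall>k. y $ k \<in> Y" for y z
  proof (cases "norm z \<le> R")
    case True
    then have "(y, z) \<in> K" using that by (simp add: K_def)
    then have "G (E (y, z)) = g (y, z)" using G(2)[of "E (y, z)"] inv by simp
    then show ?thesis using bounds[OF that True] by (simp add: \<phi>_def)
  qed (simp add: \<phi>_def cutoff_eq_0)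
  ultimately show ?thesis by (rule that)
qed

section \<open>Approximation of the integrand\<close>

text \<open>Additivity cannot be applied to \<open>f + g\<close>, as \<open>f\<close> need not be
  measurable. Instead \<open>F\<close> is split into \<open>F - g\<close>, which is measurable and
  below \<open>f\<close>, and \<open>g\<close>; monotonicity needs no measurability. Finiteness of
  \<open>g\<close> excludes \<open>\<top> - \<top> = \<top>\<close>.\<close>

lemma nn_integral_le_add_nonmeasurable:
  assumes [measurable]: "F \<in> borel_measurable M" "g \<in> borel_measurable M"
    and fin: "\<And>x. x \<in> space M \<Longrightarrow> g x < \<top>"
    and le: "\<And>x. x \<in> space M \<Longrightarrow> F x \<le> f x + g x"
  shows "(\<integral>\<^sup>+ x. F x \<partial>M) \<le> (\<integral>\<^sup>+ x. f x \<partial>M) + (\<integral>\<^sup>+ x. g x \<partial>M)"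
proof -
  have "F x \<le> (F x - g x) + g x" for x
    by (cases "g x \<le> F x") (simp_all add: diff_add_cancel_ennreal add_increasing)
  then have "(\<integral>\<^sup>+ x. F x \<partial>M) \<le> (\<integral>\<^sup>+ x. (F x - g x) + g x \<partial>M)"
    by (intro nn_integral_mono)
  also have "\<dots> = (\<integral>\<^sup>+ x. F x - g x \<partial>M) + (\<integral>\<^sup>+ x. g x \<partial>M)"
    by (rule nn_integral_add) auto
  also have "(\<integral>\<^sup>+ x. F x - g x \<partial>M) \<le> (\<integral>\<^sup>+ x. f x \<partial>M)"
    using le fin[THEN less_imp_neq] by (intro nn_integral_mono) (auto simp: ennreal_minus_le_iff add.commute)
  finally show ?thesis by (simp add: add_right_mono)
qed

text \<open>Subtracting the finite constant preserves the convergence of \<open>a\<close>, so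
  \<open>C\<close> is moved to that side first and only monotonicity of \<open>liminf\<close> is
  left for \<open>b\<close>.\<close>

lemma tendsto_le_liminf_add:
  fixes a b :: "nat \<Rightarrow> ennreal"
  assumes "a \<longlonglongrightarrow> l" and "\<forall>\<^sub>F h in sequentially. a h \<le> b h + C" and "C < \<top>"
  shows "l \<le> liminf b + C"
proof -
  have "(\<lambda>h. a h - C) \<longlonglongrightarrow> l - C"
    using assms(1,3) by (intro tendsto_diff_ennreal_general) auto
  then have "l - C = liminf (\<lambda>h. a h - C)"
    by (simp add: lim_imp_Liminf)
  also have "\<dots> \<le> liminf b"
    using assms(2) less_imp_neq[OF assms(3)] by (intro Liminf_mono) (auto elim!: eventually_mono simp: ennreal_minus_le_iff add.commute)
  finally show ?thesis
    using assms(3) by (simp add: ennreal_minus_le_iff add.commute)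
qed

lemma simple_C0_approximation:
  fixes X :: "'a::euclidean_space set" and Y :: "(real ^ 'd) set"
    and f :: "'a \<times> ((real ^ 'd) ^ 'n) \<times> (real ^ 'm) \<Rightarrow> real"
  assumes X: "compact X" and Y: "compact Y" "Y \<subseteq> unit_cube"
    and f: "continuous_on (X \<times> {y. \<forall>k. y $ k \<in> Y} \<times> UNIV) f"
    and bounds: "\<And>x y z. x \<in> X \<Longrightarrow> \<forall>k. y $ k \<in> Y \<Longrightarrow> norm z \<le> R \<Longrightarrow> 0 \<le> f (x, y, z) \<and> f (x, y, z) \<le> M"
    and "0 \<le> M" "0 < e"
  obtains \<kappa> :: "'a \<Rightarrow> nat" and \<phi> where "\<kappa> \<in> measurable borel (count_space UNIV)" "finite (range \<kappa>)"
    "\<And>i. \<phi> i \<in> C0 torus_power_times" "\<And>i. continuous_on UNIV (\<phi> i)"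
    "\<And>i p. 0 \<le> \<phi> i p" "\<And>i p. \<phi> i p \<le> M"
    "\<And>x y z. x \<in> X \<Longrightarrow> \<forall>k. y $ k \<in> Y \<Longrightarrow> \<bar>\<phi> (\<kappa> x) (y, z) - cutoff R z * f (x, y, z)\<bar> \<le> e"
proof -
  let ?Y = "{y :: (real ^ 'd) ^ 'n. \<forall>k. y $ k \<in> Y}"
  let ?K = "X \<times> ?Y \<times> cball (0 :: real ^ 'm) R"
  have uc: "uniformly_continuous_on ?K f"
    by (intro compact_uniformly_continuous compact_Times X compact_vec_power Y compact_cball
        continuous_on_subset[OF f]) auto
  obtain r where r: "0 < r" "\<And>p p'. p \<in> ?K \<Longrightarrow> p' \<in> ?K \<Longrightarrow> dist p' p < r \<Longrightarrow> dist (f p') (f p) < e"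
    by (rule uniformly_continuous_onE[OF uc \<open>0 < e\<close>], rule that, assumption)
  obtain T where T: "T \<subseteq> X" "finite T" "X \<subseteq> (\<Union>t\<in>T. ball t r)"
    using compactE_image[OF X, of X "\<lambda>t. ball t r"] r(1) by (metis UN_I centre_in_ball open_ball subsetI)
  obtain N :: nat and t where t: "T = t ` {..<N}"
    using T(2) by (metis finite_imp_nat_seg_image_inj_on lessThan_def)
  have tX: "t i \<in> X" if "i < N" for i
    using that t T(1) by auto
  \<comment> \<open>Indices from \<open>N\<close> on label no net point and receive the zero
    function, so that the family is total.\<close>
  have "\<exists>\<phi>. \<phi> \<in> C0 torus_power_times \<and> continuous_on UNIV \<phi> \<and> (\<forall>p. 0 \<le> \<phi> p \<and> \<phi> p \<le> M) \<and>
      (i < N \<longrightarrow> (\<forall>y z. (\<forall>k. y $ k \<in> Y) \<longrightarrow> \<phi> (y, z) = cutoff R z * f (t i, y, z)))"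
    for i
  proof (cases "i < N")
    case True
    have cont: "continuous_on (?Y \<times> cball 0 R) (\<lambda>p. f (t i, p))"
      by (rule continuous_on_compose2[OF f]) (use tX[OF True] in \<open>auto intro!: continuous_intros\<close>)
    have b: "0 \<le> f (t i, (y, z)) \<and> f (t i, (y, z)) \<le> M" if "\<forall>k. y $ k \<in> Y" "norm z \<le> R" for y z
      using that by (rule bounds[OF tX[OF True]])
    obtain \<phi> where \<phi>: "\<phi> \<in> C0 torus_power_times" "continuous_on UNIV \<phi>"
      "\<And>p. 0 \<le> \<phi> p" "\<And>p. \<phi> p \<le> M"
      "\<And>y z. \<forall>k. y $ k \<in> Y \<Longrightarrow> \<phi> (y, z) = cutoff R z * f (t i, y, z)"
      by (rule C0_torus_power_times_extension[OF Y cont b \<open>0 \<le> M\<close>]) (assumption, assumption, rule that)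
    then show ?thesis by (intro exI[of _ \<phi>]) simp
  next
    case False
    have "(\<lambda>_. 0) \<in> C0 torus_power_times"
      by (auto simp: C0_def intro!: exI[of _ "{}"])
    then show ?thesis using False \<open>0 \<le> M\<close> by (intro exI[of _ "\<lambda>_. 0"]) auto
  qed
  then obtain \<phi> where \<phi>: "\<And>i. \<phi> i \<in> C0 torus_power_times" "\<And>i. continuous_on UNIV (\<phi> i)"
      "\<And>i p. 0 \<le> \<phi> i p \<and> \<phi> i p \<le> M"
      "\<And>i y z. i < N \<Longrightarrow> (\<forall>k. y $ k \<in> Y) \<Longrightarrow> \<phi> i (y, z) = cutoff R z * f (t i, y, z)"
    by metis
  \<comment> \<open>\<open>\<kappa> x\<close> is the first net point within \<open>r\<close> of
    \<open>x\<close>. The alternative \<open>i = N\<close> ensures that the minimum exists and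
    bounds the range; on \<open>X\<close> it is never the one selected, since the balls cover
    \<open>X\<close>.\<close>
  define \<kappa> where "\<kappa> x = (LEAST i. i = N \<or> dist (t i) x < r)" for x
  have "\<kappa> x \<le> N" for x
    unfolding \<kappa>_def by (rule Least_le) simp
  then have "finite (range \<kappa>)"
    by (auto intro: finite_subset[of _ "{..N}"])
  moreover have "\<kappa> \<in> measurable borel (count_space UNIV)"
    unfolding \<kappa>_def by measurable
  moreover have "\<bar>\<phi> (\<kappa> x) (y, z) - cutoff R z * f (x, y, z)\<bar> \<le> e"
    if x: "x \<in> X" and y: "\<forall>k. y $ k \<in> Y" for x y z
  proof -
    obtain i where i: "i < N" "dist (t i) x < r" using x T(3) t by auto
    have "\<kappa> x \<le> i" unfolding \<kappa>_def by (rule Least_le) (simp add: i)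
    with i have N: "\<kappa> x < N" by simp
    have "\<kappa> x = N \<or> dist (t (\<kappa> x)) x < r"
      unfolding \<kappa>_def by (rule LeastI[where k = N]) simp
    with N have d: "dist (t (\<kappa> x)) x < r" by simp
    have eq: "\<phi> (\<kappa> x) (y, z) - cutoff R z * f (x, y, z) = cutoff R z * (f (t (\<kappa> x), y, z) - f (x, y, z))"
      using \<phi>(4)[OF N] y by (simp add: algebra_simps)
    show ?thesis
    proof (cases "norm z \<le> R")
      case True
      then have "\<bar>f (t (\<kappa> x), y, z) - f (x, y, z)\<bar> \<le> e"
        using r(2)[of "(x, y, z)" "(t (\<kappa> x), y, z)"] x y d tX[OF N]
        by (simp add: dist_Pair_Pair dist_real_def)
      then have "cutoff R z * \<bar>f (t (\<kappa> x), y, z) - f (x, y, z)\<bar> \<le> 1 * e"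
        by (intro mult_mono) (auto simp: cutoff_bounds)
      then show ?thesis
        unfolding eq by (simp add: abs_mult cutoff_bounds)
    next
      case False
      then show ?thesis unfolding eq using \<open>0 < e\<close> by (simp add: cutoff_eq_0)
    qed
  qed
  ultimately show ?thesis using that[of \<kappa> \<phi>] \<phi> by blast
qed

lemma nn_integral_const_add_indicator:
  fixes D B :: "'a::euclidean_space set"
  assumes [measurable]: "D \<in> sets borel" "B \<in> sets borel" and "B \<subseteq> D"
  shows "(\<integral>\<^sup>+ x. a + b * indicator B x \<partial>lebesgue_on D) = a * emeasure lborel D + b * emeasure lborel B"
proof -
  have B: "B \<in> sets (lebesgue_on D)" 
    using assms by (auto simp: sets_restrict_space_iff)
  have "(\<integral>\<^sup>+ x. a + b * indicator B x \<partial>lebesgue_on D)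
      = (\<integral>\<^sup>+ x. a \<partial>lebesgue_on D) + (\<integral>\<^sup>+ x. b * indicator B x \<partial>lebesgue_on D)"
    by (rule nn_integral_add) (use B in auto)
  also have "\<dots> = a * emeasure (lebesgue_on D) D + b * emeasure (lebesgue_on D) B"
    using B by (simp add: nn_integral_cmult_indicator)
  finally show ?thesis
    using assms by (simp add: emeasure_restrict_space)
qed

text \<open>Union bound over the bad set in \<open>x\<close> and the oscillating components, each
  estimated by \<open>emeasure_vimage_frac_vec_le\<close> with a constant that does not depend on
  its scale.\<close>

lemma emeasure_multiscale_map_avoids_le:
  fixes \<Omega> X Y :: "(real ^ 'd) set" and \<rho> :: "'n::finite \<Rightarrow> real"
  assumes [measurable]: "\<Omega> \<in> sets borel" "X \<in> sets borel" "Y \<in> sets borel"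
    and L: "\<And>x i. x \<in> \<Omega> \<Longrightarrow> \<bar>x $ i\<bar> \<le> L" "0 \<le> L" and \<rho>: "\<And>k. 0 < \<rho> k" "\<And>k. \<rho> k \<le> 1"
  shows "emeasure lborel {x \<in> \<Omega>. x \<notin> X \<or> (\<exists>k. frac_vec (x /\<^sub>R \<rho> k) \<notin> Y)}
    \<le> emeasure lborel (\<Omega> - X) + of_nat CARD('n) * (ennreal ((2 * L + 5) ^ CARD('d)) * emeasure lborel (unit_cube - Y))"
proof -
  let ?B = "\<lambda>k. {x \<in> \<Omega>. frac_vec (x /\<^sub>R \<rho> k) \<in> unit_cube - Y}"
  have [measurable]: "?B k \<in> sets borel" for k
  proof -
    have "?B k = \<Omega> \<inter> ((\<lambda>x. frac_vec (x /\<^sub>R \<rho> k)) -` (unit_cube - Y) \<inter> space borel)" by auto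
    also have "\<dots> \<in> sets borel"
      by (intro sets.Int measurable_sets[of _ borel borel]) measurable
    finally show ?thesis .
  qed
  have "emeasure lborel {x \<in> \<Omega>. x \<notin> X \<or> (\<exists>k. frac_vec (x /\<^sub>R \<rho> k) \<notin> Y)}
      = emeasure lborel ((\<Omega> - X) \<union> (\<Union>k. ?B k))"
    by (rule arg_cong[where f = "emeasure lborel"]) (auto simp: frac_vec_in_unit_cube)
  also have "\<dots> \<le> emeasure lborel (\<Omega> - X) + emeasure lborel (\<Union>k. ?B k)"
    by (rule emeasure_subadditive) (unfold sets_lborel, measurable)
  also have "emeasure lborel (\<Union>k. ?B k) \<le> (\<Sum>k\<in>UNIV. emeasure lborel (?B k))"
    by (intro emeasure_subadditive_finite finite) (unfold sets_lborel, blast intro: \<open>\<And>k. ?B k \<in> sets borel\<close>)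
  also have "\<dots> \<le> (\<Sum>k\<in>(UNIV :: 'n set). ennreal ((2 * L + 5) ^ CARD('d)) * emeasure lborel (unit_cube - Y))"
    by (intro sum_mono emeasure_vimage_frac_vec_le L \<rho>) auto
  finally show ?thesis
    by (simp add: add_left_mono)
qed

text \<open>\<open>f\<close> itself may be non-measurable off the good sets. Taking the supremum of
  its restrictions to countably many good sets, extended by zero, gives a measurable minorant that
  agrees with \<open>f\<close> wherever \<open>(x, y)\<close> lies in one of them, hence almost
  everywhere.\<close>

lemma admissible_integrand_AE_eq_measurable:
  fixes \<Omega> :: "(real ^ 'd) set" and f :: "(real ^ 'd) \<times> ((real ^ 'd) ^ 'n) \<times> (real ^ 'm) \<Rightarrow> real"
  assumes f: "admissible_integrand \<Omega> f"
    and [measurable]: "\<Omega> \<in> sets borel" and fin: "emeasure lborel \<Omega> < \<infinity>"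
  obtains H :: "(real ^ 'd) \<times> ((real ^ 'd) ^ 'n) \<Rightarrow> (real ^ 'm) \<Rightarrow> ennreal"
  where "(\<lambda>(p, z). H p z) \<in> borel_measurable (lebesgue_on (\<Omega> \<times> unit_cubes) \<Otimes>\<^sub>M borel)"
    "\<And>x y z. x \<in> \<Omega> \<Longrightarrow> y \<in> unit_cubes \<Longrightarrow> H (x, y) z \<le> ennreal (f (x, y, z))"
    "AE p in lebesgue_on (\<Omega> \<times> unit_cubes). \<forall>z. H p z = ennreal (f (fst p, snd p, z))"
proof -
  let ?U = "unit_cubes :: ((real ^ 'd) ^ 'n) set"
  let ?LP = "lebesgue_on (\<Omega> \<times> ?U)"
  have P [measurable]: "\<Omega> \<times> ?U \<in> sets borel"
    by (intro borel_Times) measurable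
  obtain v where v: "emeasure lborel \<Omega> = ennreal v" "0 \<le> v"
    using fin by (cases "emeasure lborel \<Omega>") auto
  define good where "good X Y \<delta> \<longleftrightarrow> compact X \<and> X \<subseteq> \<Omega> \<and> emeasure lebesgue (\<Omega> - X) \<le> ennreal \<delta> \<and>
        compact Y \<and> Y \<subseteq> unit_cube \<and> emeasure lebesgue (unit_cube - Y) \<le> ennreal \<delta> \<and>
        continuous_on (X \<times> {y. \<forall>k. y $ k \<in> Y} \<times> UNIV) f" for X Y \<delta>
  have "\<exists>X Y. good X Y (inverse (real (Suc j)))" for j
    using f by (simp add: admissible_integrand_def good_def)
  then obtain X Y where good: "\<And>j. good (X j) (Y j) (inverse (real (Suc j)))"
    by metis
  have XY: "compact (X j)" "emeasure lebesgue (\<Omega> - X j) \<le> ennreal (inverse (real (Suc j)))"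
      "compact (Y j)" "emeasure lebesgue (unit_cube - Y j) \<le> ennreal (inverse (real (Suc j)))"
      "continuous_on (X j \<times> {y. \<forall>k. y $ k \<in> Y j} \<times> UNIV) f" for j
    using good[of j] unfolding good_def by auto
  let ?Y = "\<lambda>j. {y :: (real ^ 'd) ^ 'n. \<forall>k. y $ k \<in> Y j}"
  have Xm [measurable]: "X j \<in> sets borel" and Ym [measurable]: "Y j \<in> sets borel"
    and Ynm [measurable]: "?Y j \<in> sets borel" for j
    using XY(1,3) compact_vec_power[OF XY(3)] by (auto intro: borel_compact)
  have XYm: "X j \<times> ?Y j \<in> sets borel" for j
    by (rule borel_Times[OF Xm Ynm])
  define A where "A = (\<Union>j. X j \<times> ?Y j)"
  have Am [measurable]: "A \<in> sets borel"
    unfolding A_def by (intro sets.countable_UN'') (use XYm in auto)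
  \<comment> \<open>The j-th good set has tolerance \<open>1 / (j + 1)\<close> and so misses only
    O(1/j) of the product; the union \<open>A\<close> misses less than each of them, hence a null
    set.\<close>
  have "emeasure lborel (\<Omega> \<times> ?U - A) \<le> ennreal (inverse (real (Suc j)) * (1 + CARD('n) * v))" for j
  proof -
    have "emeasure lborel (\<Omega> \<times> ?U - A) \<le> emeasure lborel (\<Omega> \<times> ?U - X j \<times> ?Y j)"
      by (rule emeasure_mono) (use sets.Diff[OF P XYm] in \<open>auto simp: A_def\<close>)
    also have "\<dots> \<le> emeasure lborel (\<Omega> - X j) + of_nat CARD('n) * (emeasure lborel \<Omega> * emeasure lborel (unit_cube - Y j))"
      by (rule emeasure_Times_unit_cubes_Diff_le) measurable
    also have "\<dots> \<le> ennreal (inverse (real (Suc j))) + of_nat CARD('n) * (ennreal v * ennreal (inverse (real (Suc j))))"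
      unfolding v(1) by (intro add_mono mult_left_mono order_refl zero_le)
        (use XY(2)[of j] XY(4)[of j] in simp_all)
    also have "\<dots> = ennreal (inverse (real (Suc j)) * (1 + CARD('n) * v))"
      using v(2) by (simp add: ennreal_of_nat_eq_real_of_nat ennreal_mult[symmetric] ennreal_plus[symmetric] algebra_simps del: ennreal_plus)
    finally show ?thesis .
  qed
  moreover have "(\<lambda>j. ennreal (inverse (real (Suc j)) * (1 + CARD('n) * v))) \<longlonglongrightarrow> ennreal (0 * (1 + CARD('n) * v))"
    by (intro tendsto_intros LIMSEQ_inverse_real_of_nat)
  ultimately have "emeasure lborel (\<Omega> \<times> ?U - A) \<le> 0"
    by (intro LIMSEQ_le_const[where X = "\<lambda>j. ennreal (inverse (real (Suc j)) * (1 + CARD('n) * v))"]) auto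
  then have "\<Omega> \<times> ?U - A \<in> null_sets lebesgue"
    by (intro null_sets_completionI null_setsI) (use P Am in auto)
  then have "\<Omega> \<times> ?U - A \<in> null_sets ?LP"
    by (subst null_sets_restrict_space) (use P in auto)
  then have AE: "AE p in ?LP. p \<in> A"
    by (rule AE_I') auto
  have f0: "0 \<le> f (x, y, z)" if "x \<in> \<Omega>" "y \<in> ?U" for x y z
    using f that by (auto simp: admissible_integrand_def)
  let ?A = "\<lambda>j. X j \<times> ?Y j \<times> (UNIV :: (real ^ 'm) set)"
  \<comment> \<open>Continuity on a Borel set makes the extension by zero Borel; nonnegativity of
    \<open>f\<close> keeps it below \<open>f\<close>.\<close>
  define h where "h j q = ennreal (indicator (?A j) q *\<^sub>R f q)" for j q
  have hm [measurable]: "h j \<in> borel_measurable borel" for j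
    unfolding h_def
    by (intro measurable_compose[OF _ measurable_ennreal] borel_measurable_continuous_on_indicator XY(5) borel_Times Xm Ynm) auto
  define H where "H p z = (SUP j. h j (fst p, snd p, z))" for p z
  have "(\<lambda>p. p) \<in> measurable ?LP borel"
    by (intro measurable_restrict_space1 measurable_completion) simp
  then have fm: "fst \<in> borel_measurable (?LP \<Otimes>\<^sub>M (borel :: (real ^ 'm) measure))"
    using measurable_compose[OF measurable_fst[of ?LP "borel :: (real ^ 'm) measure"]] by blast
  have "(\<lambda>q. (fst (fst q), snd (fst q), snd q)) \<in> borel_measurable (?LP \<Otimes>\<^sub>M (borel :: (real ^ 'm) measure))"
    by (intro borel_measurable_Pair measurable_compose[OF fm, of fst] measurable_compose[OF fm, of snd]
        measurable_snd borel_measurable_continuous_onI continuous_intros)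
  then have "(\<lambda>(p, z). H p z) \<in> borel_measurable (?LP \<Otimes>\<^sub>M borel)"
    unfolding H_def split_beta by (intro borel_measurable_SUP measurable_compose[OF _ hm]) auto
  moreover have "H (x, y) z \<le> ennreal (f (x, y, z))" if "x \<in> \<Omega>" "y \<in> ?U" for x y z
    unfolding H_def h_def by (rule SUP_least) (use f0[OF that] in \<open>auto split: split_indicator\<close>)
  moreover have "AE p in ?LP. \<forall>z. H p z = ennreal (f (fst p, snd p, z))"
    using AE AE_space
  proof eventually_elim
    case (elim p)
    then obtain j where j: "fst p \<in> X j" "snd p \<in> ?Y j" by (auto simp: A_def)
    show ?case
    proof
      fix z
      have "h j (fst p, snd p, z) \<le> H p z"
        unfolding H_def by (rule SUP_upper) simp
      moreover have "h j (fst p, snd p, z) = ennreal (f (fst p, snd p, z))"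
        using j by (simp add: h_def)
      moreover have "H p z \<le> ennreal (f (fst p, snd p, z))"
        unfolding H_def h_def using elim(2)
        by (intro SUP_least) (use f0[of "fst p" "snd p" z] in \<open>auto split: split_indicator\<close>)
      ultimately show "H p z = ennreal (f (fst p, snd p, z))" by simp
    qed
  qed
  ultimately show ?thesis by (rule that)
qed

section \<open>The lower bound\<close>

lemma multiscale_young_measure_liminf:
  fixes \<Omega> :: "(real ^ 'd) set"
    and \<rho> :: "'n::finite \<Rightarrow> real \<Rightarrow> real"
    and u :: "nat \<Rightarrow> (real ^ 'd) \<Rightarrow> (real ^ 'm)"
    and \<nu> :: "(real ^ 'd) \<times> ((real ^ 'd) ^ 'n) \<Rightarrow> (real ^ 'm) measure"
    and f :: "(real ^ 'd) \<times> ((real ^ 'd) ^ 'n) \<times> (real ^ 'm) \<Rightarrow> real"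
  assumes "open \<Omega>" and "bounded \<Omega>"
    and "\<And>k t. 0 < t \<Longrightarrow> 0 < \<rho> k t"
    and "\<And>k. (\<rho> k \<longlongrightarrow> 0) (at_right 0)"
    and "\<And>h. 0 < \<epsilon> h" and "\<epsilon> \<longlonglongrightarrow> 0"
    and "0 \<le> q"
    and "generates_multiscale_young_measure \<Omega> \<rho> \<epsilon> u \<nu>"
    and "admissible_integrand \<Omega> f"
    and "0 < c"
    and "\<And>x y z. x \<in> \<Omega> \<Longrightarrow> y \<in> unit_cubes \<Longrightarrow> f (x, y, z) \<le> c * (1 + norm z powr q)"
  shows "(\<integral>\<^sup>+ (x, y). (\<integral>\<^sup>+ z. ennreal (f (x, y, z)) \<partial>\<nu> (x, y)) \<partial>lebesgue_on (\<Omega> \<times> unit_cubes))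
    \<le> liminf (\<lambda>h. \<integral>\<^sup>+ x. ennreal (f (x, multiscale_map \<rho> \<epsilon> u h x)) \<partial>lebesgue_on \<Omega>)"
proof -
  let ?U = "unit_cubes :: ((real ^ 'd) ^ 'n) set"
  let ?P = "\<Omega> \<times> ?U"
  let ?L = "lebesgue_on \<Omega>" and ?LP = "lebesgue_on (\<Omega> \<times> ?U)"
  let ?w = "multiscale_map \<rho> \<epsilon> u"
  define I where "I h = (\<integral>\<^sup>+ x. ennreal (f (x, ?w h x)) \<partial>?L)" for h
  have [measurable]: "\<Omega> \<in> sets borel" using \<open>open \<Omega>\<close> by simp
  have Pm: "?P \<in> sets borel" by (intro borel_Times) measurable
  obtain L0 where L0: "\<And>x. x \<in> \<Omega> \<Longrightarrow> norm x \<le> L0"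
    using \<open>bounded \<Omega>\<close> by (auto simp: bounded_iff)
  define L where "L = max 0 L0"
  have L: "\<bar>x $ i\<bar> \<le> L" if "x \<in> \<Omega>" for x i
    using L0[OF that] component_le_norm_cart[of x i] by (simp add: L_def)
  have "0 \<le> L" by (simp add: L_def)
  have fin: "emeasure lborel \<Omega> < \<infinity>"
    using emeasure_bounded_finite[OF \<open>bounded \<Omega>\<close>] by simp
  then obtain v where v: "emeasure lborel \<Omega> = ennreal v" "0 \<le> v"
    by (cases "emeasure lborel \<Omega>") auto
  have vP: "emeasure lborel ?P = ennreal v"
    using lborel.emeasure_pair_measure_Times[of \<Omega> lborel ?U]
    by (simp add: lborel_prod emeasure_unit_cubes v)
  \<comment> \<open>\<open>D\<close> covers both exceptional sets at once: 1 for the part outside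
    \<open>X\<close>, the second term for the components of \<open>?w h\<close>, the third for those
    of \<open>y\<close>. Either set then has measure at most \<open>\<delta> * D\<close>.\<close>
  define D where "D = 1 + CARD('n) * (2 * L + 5) ^ CARD('d) + CARD('n) * v"
  have "1 \<le> D" using \<open>0 \<le> L\<close> v(2) by (simp add: D_def)

  have f0: "0 \<le> f (x, y, z)" if "x \<in> \<Omega>" "y \<in> ?U" for x y z
    using \<open>admissible_integrand \<Omega> f\<close> that by (auto simp: admissible_integrand_def)
  have \<nu>y: "\<nu> \<in> young_measures ?P euclidean"
    using \<open>generates_multiscale_young_measure \<Omega> \<rho> \<epsilon> u \<nu>\<close>
    by (simp add: generates_multiscale_young_measure_def)
  obtain \<mu> where gen: "generates_young_measure \<Omega> torus_power_times ?w \<mu>"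
    and \<mu>\<nu>: "\<And>g :: (real ^ 'd) \<times> ((real ^ 'd) ^ 'n) \<times> (real ^ 'm) \<Rightarrow> ennreal.
           g \<in> borel_measurable (?L \<Otimes>\<^sub>M borel_of torus_power_times) \<Longrightarrow>
           (\<integral>\<^sup>+ x. (\<integral>\<^sup>+ (y, z). g (x, y, z) \<partial>\<mu> x) \<partial>?L) =
           (\<integral>\<^sup>+ (x, y). (\<integral>\<^sup>+ z. g (x, y, z) \<partial>\<nu> (x, y)) \<partial>?LP)"
    using \<open>generates_multiscale_young_measure \<Omega> \<rho> \<epsilon> u \<nu>\<close>
    unfolding generates_multiscale_young_measure_def by blast
  have wm: "?w h \<in> measurable ?L (borel_of torus_power_times)" for h
    using gen by (simp add: generates_young_measure_def)
  obtain \<nu>' where \<nu>'m: "\<nu>' \<in> measurable ?LP (prob_algebra borel)" and \<nu>': "AE p in ?LP. \<nu>' p = \<nu> p"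
  proof (rule young_measure_AE_eq_kernel[OF \<nu>y])
    show "?P \<in> sets lebesgue" using Pm by simp
  qed (rule that)
  have \<nu>'s [measurable]: "\<nu>' \<in> measurable ?LP (subprob_algebra borel)"
    using \<nu>'m by (rule measurable_prob_algebraD)
  have prob: "prob_space (\<nu>' p)" and sets\<nu>': "sets (\<nu>' p) = sets borel" if "p \<in> ?P" for p
    using measurable_space[OF \<nu>'m, of p] that by (auto simp: space_prob_algebra)
  obtain H :: "(real ^ 'd) \<times> ((real ^ 'd) ^ 'n) \<Rightarrow> (real ^ 'm) \<Rightarrow> ennreal"
    where Hm [measurable]: "(\<lambda>(p, z). H p z) \<in> borel_measurable (?LP \<Otimes>\<^sub>M borel)"
    and Hle: "\<And>x y z. x \<in> \<Omega> \<Longrightarrow> y \<in> ?U \<Longrightarrow> H (x, y) z \<le> ennreal (f (x, y, z))"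
    and Heq: "AE p in ?LP. \<forall>z. H p z = ennreal (f (fst p, snd p, z))"
    by (rule admissible_integrand_AE_eq_measurable[OF \<open>admissible_integrand \<Omega> f\<close> _ fin]) auto

  have kernel: "(\<lambda>p. \<integral>\<^sup>+ z. G p z \<partial>\<nu>' p) \<in> borel_measurable ?LP"
    if "(\<lambda>(p, z). G p z) \<in> borel_measurable (?LP \<Otimes>\<^sub>M borel)" for G
    using that \<nu>'s by (rule nn_integral_measurable_subprob_algebra2)

  \<comment> \<open>The estimate for the truncated integrand\<close>
  have truncated: "(\<integral>\<^sup>+ p. (\<integral>\<^sup>+ z. ennreal (cutoff R z) * H p z \<partial>\<nu>' p) \<partial>?LP) \<le> liminf I + ennreal (2 * (e * v + e))"
    if "1 \<le> R" and "0 < e" for R e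
  proof -
    \<comment> \<open>The growth condition at radius \<open>R\<close>; for larger
      \<open>norm z\<close> the cutoff vanishes, so \<open>M\<close> bounds the truncated integrand
      everywhere.\<close>
    define M where "M = c * (1 + R powr q)"
    have "0 < M" using \<open>0 < c\<close> by (simp add: M_def add_pos_nonneg)
    have fM: "f (x, y, z) \<le> M" if "x \<in> \<Omega>" "y \<in> ?U" "norm z \<le> R" for x y z
    proof -
      have "norm z powr q \<le> R powr q"
        using that(3) \<open>0 \<le> q\<close> by (intro powr_mono2) auto
      then have "c * (1 + norm z powr q) \<le> M"
        using \<open>0 < c\<close> by (simp add: M_def)
      with assms(11)[OF that(1,2), of z] show ?thesis by linarith
    qed
    have cfM: "cutoff R z * f (x, y, z) \<le> M" if "x \<in> \<Omega>" "y \<in> ?U" for x y z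
    proof (cases "norm z \<le> R")
      case True
      have "cutoff R z * f (x, y, z) \<le> 1 * M"
        using fM[OF that True] f0[OF that] by (intro mult_mono) (auto simp: cutoff_bounds)
      then show ?thesis by simp
    qed (use \<open>0 < M\<close> in \<open>simp add: cutoff_eq_0\<close>)
    have cf: "cutoff R z * f (x, y, z) \<le> f (x, y, z)" if "x \<in> \<Omega>" "y \<in> ?U" for x y z
      using f0[OF that] cutoff_bounds[of R z] by (simp add: mult_left_le_one_le)
    \<comment> \<open>Chosen so that a function bounded by \<open>M\<close> contributes at most
      \<open>e\<close> on an exceptional set of measure \<open>\<delta> * D\<close>.\<close>
    define \<delta> where "\<delta> = e / (M * D)"
    have "0 < \<delta>" using \<open>0 < e\<close> \<open>0 < M\<close> \<open>1 \<le> D\<close> by (simp add: \<delta>_def)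
    have M\<delta>: "M * (\<delta> * D) = e" using \<open>0 < M\<close> \<open>1 \<le> D\<close> by (simp add: \<delta>_def)
    obtain X Y where X: "compact X" "X \<subseteq> \<Omega>" "emeasure lebesgue (\<Omega> - X) \<le> ennreal \<delta>"
      and Y: "compact Y" "Y \<subseteq> unit_cube" "emeasure lebesgue (unit_cube - Y) \<le> ennreal \<delta>"
      and cont: "continuous_on (X \<times> {y. \<forall>k. y $ k \<in> Y} \<times> UNIV) f"
      using \<open>admissible_integrand \<Omega> f\<close> \<open>0 < \<delta>\<close> unfolding admissible_integrand_def by blast
    have [measurable]: "X \<in> sets borel" "Y \<in> sets borel"
      using X(1) Y(1) by (auto intro: borel_compact)
    have X\<delta>: "emeasure lborel (\<Omega> - X) \<le> ennreal \<delta>" and Y\<delta>: "emeasure lborel (unit_cube - Y) \<le> ennreal \<delta>"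
      using X(3) Y(3) by simp_all
    have YU: "y \<in> ?U" if "\<forall>k. y $ k \<in> Y" for y
      using that Y(2) by (auto simp: unit_cubes_def)
    have bounds: "0 \<le> f (x, y, z) \<and> f (x, y, z) \<le> M" if "x \<in> X" "\<forall>k. y $ k \<in> Y" "norm z \<le> R" for x y z
      using that X(2) YU by (auto intro!: f0 fM)
    obtain \<kappa> :: "real ^ 'd \<Rightarrow> nat" and \<phi> where \<kappa>: "\<kappa> \<in> measurable borel (count_space UNIV)" "finite (range \<kappa>)"
      and \<phi>: "\<And>i. \<phi> i \<in> C0 torus_power_times" "\<And>i. continuous_on UNIV (\<phi> i)"
        "\<And>i p. 0 \<le> \<phi> i p" "\<And>i p. \<phi> i p \<le> M"
      and \<phi>f: "\<And>x y z. x \<in> X \<Longrightarrow> \<forall>k. y $ k \<in> Y \<Longrightarrow> \<bar>\<phi> (\<kappa> x) (y, z) - cutoff R z * f (x, y, z)\<bar> \<le> e"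
      by (rule simple_C0_approximation[OF X(1) Y(1,2) cont bounds less_imp_le[OF \<open>0 < M\<close>] \<open>0 < e\<close>])
        (assumption, assumption, assumption, rule that)
    have \<kappa>L [measurable]: "\<kappa> \<in> measurable ?L (count_space UNIV)"
      using \<kappa>(1) by (intro measurable_restrict_space1 measurable_completion) simp
    have \<kappa>s: "simple_function ?L \<kappa>"
      unfolding simple_function_def
      using finite_subset[OF _ \<kappa>(2), of "\<kappa> ` \<Omega>"] measurable_sets[OF \<kappa>L] by auto
    \<comment> \<open>\<open>J\<close> links the two sides: it is the limit of the test integrals
      along the sequence and, by the identity defining \<open>\<nu>\<close>, their integral against
      \<open>\<nu>\<close>. Each comparison with \<open>J\<close> costs \<open>e * v\<close> for the
      approximation and \<open>e\<close> for the exceptional set.\<close>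
    define J where "J = (\<integral>\<^sup>+ x. (\<integral>\<^sup>+ s. ennreal (\<phi> (\<kappa> x) s) \<partial>\<mu> x) \<partial>?L)"
    have J_lim: "(\<lambda>h. \<integral>\<^sup>+ x. ennreal (\<phi> (\<kappa> x) (?w h x)) \<partial>?L) \<longlonglongrightarrow> J"
      unfolding J_def
    proof (rule generates_young_measure_simple[OF gen _ _ _ \<kappa>s \<phi>(1)])
      have "(0 :: (real ^ 'd) ^ 'n) \<in> unit_cubes" by (simp add: unit_cubes_def unit_cube_def)
      then show "topspace torus_power_times \<noteq> ({} :: (((real ^ 'd) ^ 'n) \<times> (real ^ 'm)) set)"
        by (auto simp: topspace_torus_power)
    qed (use \<phi> fin in auto)
    have \<phi>S [measurable]: "\<phi> i \<in> borel_measurable (borel_of torus_power_times)" for i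
      using \<phi>(1) by (intro borel_measurable_borel_of) (auto simp: C0_def)

    \<comment> \<open>Comparison along the sequence\<close>
    have "J \<le> liminf I + ennreal (e * v + e)"
    proof (rule tendsto_le_liminf_add[OF J_lim])
      \<comment> \<open>The cell count requires scales of at most 1; this holds eventually, for all
        finitely many \<open>k\<close> together.\<close>
      have "\<forall>\<^sub>F h in sequentially. \<rho> k (\<epsilon> h) < 1" for k
      proof -
        have "filterlim \<epsilon> (at_right 0) sequentially"
          using \<open>\<epsilon> \<longlonglongrightarrow> 0\<close> assms(5) by (simp add: filterlim_at less_imp_neq[OF assms(5), symmetric])
        from filterlim_compose[OF assms(4)[of k] this] show ?thesis
          by (rule order_tendstoD) simp
      qed
      then have "\<forall>\<^sub>F h in sequentially. \<forall>k. \<rho> k (\<epsilon> h) < 1"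
        by (simp add: eventually_all_finite)
      then show "\<forall>\<^sub>F h in sequentially. (\<integral>\<^sup>+ x. ennreal (\<phi> (\<kappa> x) (?w h x)) \<partial>?L) \<le> I h + ennreal (e * v + e)"
      proof eventually_elim
        case (elim h)
        define B where "B = {x \<in> \<Omega>. x \<notin> X \<or> (\<exists>k. frac_vec (x /\<^sub>R \<rho> k (\<epsilon> h)) \<notin> Y)}"
        have Bm: "B \<in> sets borel"
        proof -
          have "B = (\<Omega> - X) \<union> (\<Union>k. \<Omega> \<inter> ((\<lambda>x. frac_vec (x /\<^sub>R \<rho> k (\<epsilon> h))) -` (- Y) \<inter> space borel))"
            by (auto simp: B_def)
          also have "\<dots> \<in> sets borel"
            by (intro sets.Un sets.finite_UN sets.Int measurable_sets[of _ borel borel]) measurable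
          finally show ?thesis .
        qed
        have "emeasure lborel B \<le> emeasure lborel (\<Omega> - X)
          + of_nat CARD('n) * (ennreal ((2 * L + 5) ^ CARD('d)) * emeasure lborel (unit_cube - Y))"
          unfolding B_def
          by (rule emeasure_multiscale_map_avoids_le) (use L \<open>0 \<le> L\<close> elim assms(3,5) in \<open>auto intro: less_imp_le\<close>)
        also have "\<dots> \<le> ennreal \<delta> + of_nat CARD('n) * (ennreal ((2 * L + 5) ^ CARD('d)) * ennreal \<delta>)"
          by (intro add_mono mult_left_mono X\<delta> Y\<delta>) auto
        also have "\<dots> = ennreal (\<delta> + CARD('n) * ((2 * L + 5) ^ CARD('d) * \<delta>))"
          using \<open>0 < \<delta>\<close> \<open>0 \<le> L\<close>
          by (simp add: ennreal_of_nat_eq_real_of_nat ennreal_mult[symmetric] ennreal_plus[symmetric] del: ennreal_plus)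
        also have "\<dots> \<le> ennreal (\<delta> * D)"
          using \<open>0 < \<delta>\<close> v(2) by (intro ennreal_leI) (simp add: D_def algebra_simps)
        finally have B\<delta>: "emeasure lborel B \<le> ennreal (\<delta> * D)" .
        \<comment> \<open>Off \<open>B\<close> the test function is within \<open>e\<close> of the
          truncated integrand, which lies below \<open>f\<close>; on \<open>B\<close> only the bound
          \<open>M\<close> is used. The possibly non-measurable composition stays on the larger
          side.\<close>
        have "(\<integral>\<^sup>+ x. ennreal (\<phi> (\<kappa> x) (?w h x)) \<partial>?L)
          \<le> I h + (\<integral>\<^sup>+ x. ennreal e + ennreal M * indicator B x \<partial>?L)"
          unfolding I_def
        proof (rule nn_integral_le_add_nonmeasurable)
          show "(\<lambda>x. ennreal (\<phi> (\<kappa> x) (?w h x))) \<in> borel_measurable ?L"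
            by (rule measurable_compose[OF measurable_compose_countable[of "\<lambda>i x. \<phi> i (?w h x)",
                OF measurable_compose[OF wm \<phi>S] \<kappa>L] measurable_ennreal])
          have "B \<in> sets ?L"
            using Bm by (auto simp: sets_restrict_space_iff B_def)
          then show "(\<lambda>x. ennreal e + ennreal M * indicator B x) \<in> borel_measurable ?L"
            by measurable
          fix x assume "x \<in> space ?L"
          then have x: "x \<in> \<Omega>" by simp
          show "ennreal e + ennreal M * indicator B x < \<top>" by (auto split: split_indicator)
          obtain y z where yz: "?w h x = (y, z)" by fastforce
          then have y: "y $ k = frac_vec (x /\<^sub>R \<rho> k (\<epsilon> h))" for k
            by (auto simp: multiscale_map_def)
          then have yU: "y \<in> ?U" by (simp add: unit_cubes_def frac_vec_in_unit_cube)
          show "ennreal (\<phi> (\<kappa> x) (?w h x)) \<le> ennreal (f (x, ?w h x)) + (ennreal e + ennreal M * indicator B x)"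
          proof (cases "x \<in> B")
            case True
            then show ?thesis
              using \<phi>(4)[of "\<kappa> x" "?w h x"] by (simp add: add_increasing ennreal_leI)
          next
            case False
            then have "x \<in> X" "\<forall>k. y $ k \<in> Y" using x y by (auto simp: B_def)
            from \<phi>f[OF this, of z] cf[OF x yU, of z] have "\<phi> (\<kappa> x) (y, z) \<le> f (x, y, z) + e"
              by linarith
            then show ?thesis
              using False f0[OF x yU, of z] \<open>0 < e\<close>
              by (simp add: yz ennreal_plus[symmetric] ennreal_leI del: ennreal_plus)
          qed
        qed
        also have "(\<integral>\<^sup>+ x. ennreal e + ennreal M * indicator B x \<partial>?L) = ennreal e * ennreal v + ennreal M * emeasure lborel B"
          using Bm by (subst nn_integral_const_add_indicator) (auto simp: B_def v)
        also have "\<dots> \<le> ennreal e * ennreal v + ennreal M * ennreal (\<delta> * D)"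
          by (intro add_left_mono mult_left_mono B\<delta>) auto
        also have "\<dots> = ennreal (e * v + e)"
          using \<open>0 < e\<close> \<open>0 < M\<close> \<open>0 < \<delta>\<close> \<open>1 \<le> D\<close> v(2) M\<delta>
          by (simp add: ennreal_mult[symmetric] ennreal_plus[symmetric] del: ennreal_plus)
        finally show ?case by (simp add: add_left_mono)
      qed
    qed simp

    \<comment> \<open>Comparison in the limit\<close>
    moreover have "(\<integral>\<^sup>+ p. (\<integral>\<^sup>+ z. ennreal (cutoff R z) * H p z \<partial>\<nu>' p) \<partial>?LP) \<le> J + ennreal (e * v + e)"
    proof -
      define B where "B = ?P - X \<times> {y. \<forall>k. y $ k \<in> Y}"
      have Ym: "{y :: (real ^ 'd) ^ 'n. \<forall>k. y $ k \<in> Y} \<in> sets borel"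
        using compact_vec_power[OF Y(1)] by (rule borel_compact)
      have Bm: "B \<in> sets borel"
        unfolding B_def by (rule sets.Diff[OF Pm borel_Times[OF _ Ym]]) measurable
      have BL: "B \<in> sets ?LP"
        using Bm Pm by (auto simp: sets_restrict_space_iff B_def)
      have "emeasure lborel B \<le> emeasure lborel (\<Omega> - X)
        + of_nat CARD('n) * (emeasure lborel \<Omega> * emeasure lborel (unit_cube - Y))"
        unfolding B_def by (rule emeasure_Times_unit_cubes_Diff_le) measurable
      also have "\<dots> \<le> ennreal \<delta> + of_nat CARD('n) * (ennreal v * ennreal \<delta>)"
        unfolding v(1) by (intro add_mono mult_left_mono X\<delta> Y\<delta>) auto
      also have "\<dots> = ennreal (\<delta> + CARD('n) * (v * \<delta>))"
        using \<open>0 < \<delta>\<close> v(2)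
        by (simp add: ennreal_of_nat_eq_real_of_nat ennreal_mult[symmetric] ennreal_plus[symmetric] del: ennreal_plus)
      also have "\<dots> \<le> ennreal (\<delta> * D)"
        using \<open>0 < \<delta>\<close> \<open>0 \<le> L\<close> by (intro ennreal_leI) (simp add: D_def algebra_simps)
      finally have B\<delta>: "emeasure lborel B \<le> ennreal (\<delta> * D)" .
      have idm: "(\<lambda>p. p) \<in> measurable ?LP borel"
        by (intro measurable_restrict_space1 measurable_completion) simp
      have Fm: "(\<lambda>(p, z). ennreal (\<phi> (\<kappa> (fst p)) (snd p, z))) \<in> borel_measurable (?LP \<Otimes>\<^sub>M borel)"
      proof -
        have fm: "fst \<in> borel_measurable (?LP \<Otimes>\<^sub>M (borel :: (real ^ 'm) measure))"
          by (rule measurable_compose[OF measurable_fst idm])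
        have sm: "(\<lambda>q. (snd (fst q), snd q)) \<in> borel_measurable (?LP \<Otimes>\<^sub>M (borel :: (real ^ 'm) measure))"
          by (intro borel_measurable_Pair measurable_compose[OF fm, of snd] measurable_snd
              borel_measurable_continuous_onI continuous_intros)
        have "(\<lambda>q. \<kappa> (fst (fst q))) \<in> measurable (?LP \<Otimes>\<^sub>M (borel :: (real ^ 'm) measure)) (count_space UNIV)"
          by (intro measurable_compose[OF _ \<kappa>(1)] measurable_compose[OF fm, of fst]
              borel_measurable_continuous_onI continuous_intros)
        then have "(\<lambda>q. \<phi> (\<kappa> (fst (fst q))) (snd (fst q), snd q)) \<in> borel_measurable (?LP \<Otimes>\<^sub>M (borel :: (real ^ 'm) measure))"
          by (rule measurable_compose_countable[of "\<lambda>i q. \<phi> i (snd (fst q), snd q)",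
              OF measurable_compose[OF sm borel_measurable_continuous_onI[OF \<phi>(2)]]])
        then show ?thesis
          unfolding split_beta by (rule measurable_compose[OF _ measurable_ennreal])
      qed
      \<comment> \<open>The approximation is now used in the other direction, so the cutoff has to
        stay; on \<open>B\<close> it is the truncated integrand that is bounded by
        \<open>M\<close>.\<close>
      have pointwise: "ennreal (cutoff R z) * H (x, y) z
          \<le> ennreal (\<phi> (\<kappa> x) (y, z)) + (ennreal e + ennreal M * indicator B (x, y))"
        if x: "x \<in> \<Omega>" and y: "y \<in> ?U" for x y z
      proof -
        have "ennreal (cutoff R z) * H (x, y) z \<le> ennreal (cutoff R z) * ennreal (f (x, y, z))"
          by (intro mult_left_mono Hle x y) auto
        also have "\<dots> = ennreal (cutoff R z * f (x, y, z))"
          using f0[OF x y] by (simp add: ennreal_mult cutoff_bounds)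
        also have "\<dots> \<le> ennreal (\<phi> (\<kappa> x) (y, z)) + (ennreal e + ennreal M * indicator B (x, y))"
        proof (cases "(x, y) \<in> B")
          case True
          then show ?thesis
            using cfM[OF x y, of z] by (simp add: add_increasing ennreal_leI)
        next
          case False
          then have "x \<in> X" "\<forall>k. y $ k \<in> Y" using x y by (auto simp: B_def)
          from \<phi>f[OF this, of z] have "cutoff R z * f (x, y, z) \<le> \<phi> (\<kappa> x) (y, z) + e"
            by linarith
          then show ?thesis
            using False \<phi>(3) \<open>0 < e\<close>
            by (simp add: ennreal_plus[symmetric] ennreal_leI del: ennreal_plus)
        qed
        finally show ?thesis .
      qed
      \<comment> \<open>The error term does not depend on \<open>z\<close>, so integrating it
        against the probability measure \<open>\<nu>' p\<close> leaves it unchanged.\<close>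
      have "(\<integral>\<^sup>+ p. (\<integral>\<^sup>+ z. ennreal (cutoff R z) * H p z \<partial>\<nu>' p) \<partial>?LP)
        \<le> (\<integral>\<^sup>+ p. (\<integral>\<^sup>+ z. ennreal (\<phi> (\<kappa> (fst p)) (snd p, z)) \<partial>\<nu>' p) + (ennreal e + ennreal M * indicator B p) \<partial>?LP)"
      proof (rule nn_integral_mono)
        fix p assume "p \<in> space ?LP"
        then have p: "p \<in> ?P" by simp
        interpret p: prob_space "\<nu>' p" by (rule prob[OF p])
        have "(\<integral>\<^sup>+ z. ennreal (cutoff R z) * H p z \<partial>\<nu>' p)
          \<le> (\<integral>\<^sup>+ z. ennreal (\<phi> (\<kappa> (fst p)) (snd p, z)) + (ennreal e + ennreal M * indicator B p) \<partial>\<nu>' p)"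
          using p pointwise by (intro nn_integral_mono) auto
        also have "\<dots> = (\<integral>\<^sup>+ z. ennreal (\<phi> (\<kappa> (fst p)) (snd p, z)) \<partial>\<nu>' p) + (\<integral>\<^sup>+ z. ennreal e + ennreal M * indicator B p \<partial>\<nu>' p)"
        proof (rule nn_integral_add)
          have "(\<lambda>z. \<phi> (\<kappa> (fst p)) (snd p, z)) \<in> borel_measurable borel"
            by (intro borel_measurable_continuous_onI continuous_on_compose2[OF \<phi>(2)] continuous_intros) auto
          then show "(\<lambda>z. ennreal (\<phi> (\<kappa> (fst p)) (snd p, z))) \<in> borel_measurable (\<nu>' p)"
            by (simp cong: measurable_cong_sets add: sets\<nu>'[OF p])
        qed simp
        also have "(\<integral>\<^sup>+ z. ennreal e + ennreal M * indicator B p \<partial>\<nu>' p) = ennreal e + ennreal M * indicator B p"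
          by (simp add: p.emeasure_space_1)
        finally show "(\<integral>\<^sup>+ z. ennreal (cutoff R z) * H p z \<partial>\<nu>' p)
          \<le> (\<integral>\<^sup>+ z. ennreal (\<phi> (\<kappa> (fst p)) (snd p, z)) \<partial>\<nu>' p) + (ennreal e + ennreal M * indicator B p)" .
      qed
      also have "\<dots> = (\<integral>\<^sup>+ p. (\<integral>\<^sup>+ z. ennreal (\<phi> (\<kappa> (fst p)) (snd p, z)) \<partial>\<nu>' p) \<partial>?LP)
          + (\<integral>\<^sup>+ p. ennreal e + ennreal M * indicator B p \<partial>?LP)"
        by (intro nn_integral_add kernel[OF Fm]) (use BL in measurable)
      also have "(\<integral>\<^sup>+ p. ennreal e + ennreal M * indicator B p \<partial>?LP) = ennreal e * ennreal v + ennreal M * emeasure lborel B"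
        by (subst nn_integral_const_add_indicator[OF Pm Bm]) (auto simp: B_def vP)
      also have "(\<integral>\<^sup>+ p. (\<integral>\<^sup>+ z. ennreal (\<phi> (\<kappa> (fst p)) (snd p, z)) \<partial>\<nu>' p) \<partial>?LP)
        = (\<integral>\<^sup>+ p. (\<integral>\<^sup>+ z. ennreal (\<phi> (\<kappa> (fst p)) (snd p, z)) \<partial>\<nu> p) \<partial>?LP)"
        by (rule nn_integral_cong_AE) (use \<nu>' in eventually_elim, simp)
      \<comment> \<open>The identity that defines \<open>\<nu>\<close> applies to the test function,
        which is measurable for the Borel structure of the torus.\<close>
      also have "\<dots> = J"
      proof -
        have "(\<lambda>q. ennreal (\<phi> (\<kappa> (fst q)) (snd q))) \<in> borel_measurable (?L \<Otimes>\<^sub>M borel_of torus_power_times)"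
          by (rule measurable_compose[OF measurable_compose_countable[of "\<lambda>i q. \<phi> i (snd q)",
              OF measurable_compose[OF measurable_snd \<phi>S] measurable_compose[OF measurable_fst \<kappa>L]] measurable_ennreal])
        from \<mu>\<nu>[OF this] show ?thesis by (simp add: J_def case_prod_beta')
      qed
      also have "J + (ennreal e * ennreal v + ennreal M * emeasure lborel B)
          \<le> J + (ennreal e * ennreal v + ennreal M * ennreal (\<delta> * D))"
        by (intro add_left_mono mult_left_mono B\<delta>) auto
      also have "ennreal e * ennreal v + ennreal M * ennreal (\<delta> * D) = ennreal (e * v + e)"
        using \<open>0 < e\<close> \<open>0 < M\<close> \<open>0 < \<delta>\<close> \<open>1 \<le> D\<close> v(2) M\<delta>
        by (simp add: ennreal_mult[symmetric] ennreal_plus[symmetric] del: ennreal_plus)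
      finally show ?thesis .
    qed
    ultimately have "(\<integral>\<^sup>+ p. (\<integral>\<^sup>+ z. ennreal (cutoff R z) * H p z \<partial>\<nu>' p) \<partial>?LP)
        \<le> (liminf I + ennreal (e * v + e)) + ennreal (e * v + e)"
      by (meson add_right_mono order_trans)
    also have "\<dots> = liminf I + ennreal (2 * (e * v + e))"
      using \<open>0 < e\<close> v(2) unfolding add.assoc
      by (subst ennreal_plus[symmetric]) (auto simp: field_simps)
    finally show ?thesis .
  qed

  \<comment> \<open>Removal of the error and of the truncation\<close>
  have cut: "(\<integral>\<^sup>+ p. (\<integral>\<^sup>+ z. ennreal (cutoff (real (Suc j)) z) * H p z \<partial>\<nu>' p) \<partial>?LP) \<le> liminf I" for j
  proof (rule ennreal_le_epsilon)
    fix e :: real assume "0 < e"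
    \<comment> \<open>Twice \<open>?e * v + ?e\<close> is exactly \<open>e\<close>.\<close>
    let ?e = "e / (2 * (v + 1))"
    have "2 * (?e * v + ?e) = e"
      using v(2) by (simp add: divide_simps) (simp add: algebra_simps)
    then show "(\<integral>\<^sup>+ p. (\<integral>\<^sup>+ z. ennreal (cutoff (real (Suc j)) z) * H p z \<partial>\<nu>' p) \<partial>?LP) \<le> liminf I + ennreal e"
      using truncated[of "real (Suc j)" ?e] \<open>0 < e\<close> v(2) by simp
  qed
  have cm: "(\<lambda>(p, z). ennreal (cutoff R z) * H p z) \<in> borel_measurable (?LP \<Otimes>\<^sub>M borel)" for R
  proof -
    have [measurable]: "cutoff R \<in> borel_measurable (borel :: (real ^ 'm) measure)"
      using continuous_on_cutoff[OF continuous_on_id] by (rule borel_measurable_continuous_onI)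
    show ?thesis unfolding split_beta using Hm unfolding split_beta by measurable
  qed
  have SUP: "(SUP j. ennreal (cutoff (real (Suc j)) z) * H p z) = H p z" for p z
  proof (rule antisym)
    show "(SUP j. ennreal (cutoff (real (Suc j)) z) * H p z) \<le> H p z"
    proof (rule SUP_least)
      fix j
      have "ennreal (cutoff (real (Suc j)) z) * H p z \<le> 1 * H p z"
        by (intro mult_right_mono) (auto simp: cutoff_bounds)
      then show "ennreal (cutoff (real (Suc j)) z) * H p z \<le> H p z" by simp
    qed
    \<comment> \<open>The cutoff equals 1 only up to norm \<open>R - 1\<close>; the successor
      supplies that extra unit, so the supremum is attained at a finite index.\<close>
    have "cutoff (real (Suc (nat \<lceil>norm z\<rceil>))) z = 1"
      by (rule cutoff_eq_1) linarith
    then show "H p z \<le> (SUP j. ennreal (cutoff (real (Suc j)) z) * H p z)"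
      by (intro SUP_upper2[of "nat \<lceil>norm z\<rceil>"]) auto
  qed
  have inc: "incseq (\<lambda>j. ennreal (cutoff (real (Suc j)) z) * H p z)" for p z
    by (intro incseq_SucI mult_right_mono ennreal_leI cutoff_mono) auto
  \<comment> \<open>Passing to \<open>H\<close> and \<open>\<nu>'\<close>, equal to \<open>f\<close>
    and \<open>\<nu>\<close> for almost every \<open>(x, y)\<close>, supplies the measurability for
    monotone convergence, applied first in \<open>z\<close> and then in \<open>p\<close>.\<close>
  have "(\<integral>\<^sup>+ (x, y). (\<integral>\<^sup>+ z. ennreal (f (x, y, z)) \<partial>\<nu> (x, y)) \<partial>?LP)
    = (\<integral>\<^sup>+ p. (\<integral>\<^sup>+ z. H p z \<partial>\<nu>' p) \<partial>?LP)"
    by (rule nn_integral_cong_AE) (use Heq \<nu>' in \<open>eventually_elim, simp add: split_beta\<close>)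
  also have "\<dots> = (\<integral>\<^sup>+ p. (SUP j. \<integral>\<^sup>+ z. ennreal (cutoff (real (Suc j)) z) * H p z \<partial>\<nu>' p) \<partial>?LP)"
  proof (rule nn_integral_cong)
    fix p assume "p \<in> space ?LP"
    then have p: "p \<in> ?P" by simp
    have m: "(\<lambda>z. ennreal (cutoff R z) * H p z) \<in> borel_measurable (\<nu>' p)" for R
      using measurable_compose_Pair1[OF \<open>p \<in> space ?LP\<close> cm[of R]]
      by (simp cong: measurable_cong_sets add: sets\<nu>'[OF p])
    have "(\<integral>\<^sup>+ z. H p z \<partial>\<nu>' p) = (\<integral>\<^sup>+ z. (SUP j. ennreal (cutoff (real (Suc j)) z) * H p z) \<partial>\<nu>' p)"
      by (simp only: SUP)
    also have "\<dots> = (SUP j. \<integral>\<^sup>+ z. ennreal (cutoff (real (Suc j)) z) * H p z \<partial>\<nu>' p)"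
      by (rule nn_integral_monotone_convergence_SUP[OF _ m]) (use inc in \<open>simp add: incseq_def le_fun_def\<close>)
    finally show "(\<integral>\<^sup>+ z. H p z \<partial>\<nu>' p) = (SUP j. \<integral>\<^sup>+ z. ennreal (cutoff (real (Suc j)) z) * H p z \<partial>\<nu>' p)" .
  qed
  also have "\<dots> = (SUP j. \<integral>\<^sup>+ p. (\<integral>\<^sup>+ z. ennreal (cutoff (real (Suc j)) z) * H p z \<partial>\<nu>' p) \<partial>?LP)"
  proof (rule nn_integral_monotone_convergence_SUP)
    show "incseq (\<lambda>j p. \<integral>\<^sup>+ z. ennreal (cutoff (real (Suc j)) z) * H p z \<partial>\<nu>' p)"
      using inc by (auto simp: incseq_def le_fun_def intro!: nn_integral_mono)
  qed (rule kernel[OF cm])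
  also have "\<dots> \<le> liminf I"
    by (rule SUP_least) (rule cut)
  finally show ?thesis
    unfolding I_def .
qed

theorem theorem4p14:
  fixes \<Omega> :: "(real ^ 'd) set"
    and \<rho> :: "'n::{finite,linorder} \<Rightarrow> real \<Rightarrow> real"
    and \<epsilon> :: "nat \<Rightarrow> real"
    and u :: "nat \<Rightarrow> (real ^ 'd) \<Rightarrow> (real ^ 'm)"
    and \<nu> :: "(real ^ 'd) \<times> ((real ^ 'd) ^ 'n::{finite,linorder}) \<Rightarrow> (real ^ 'm) measure"
    and f :: "(real ^ 'd) \<times> ((real ^ 'd) ^ 'n::{finite,linorder}) \<times> (real ^ 'm) \<Rightarrow> real"
    and q c :: real
  assumes "open \<Omega>" and "bounded \<Omega>"
    and "\<And>k t. 0 < t \<Longrightarrow> 0 < \<rho> k t"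
    and "\<And>k. (\<rho> k \<longlongrightarrow> 0) (at_right 0)"
    and "\<And>j k. j < k \<Longrightarrow> {j<..<k} = {} \<Longrightarrow> ((\<lambda>t. \<rho> k t / \<rho> j t) \<longlongrightarrow> 0) (at_right 0)"
    and "\<And>h. 0 < \<epsilon> h" and "\<epsilon> \<longlonglongrightarrow> 0"
    and "1 \<le> q" and "bounded_in_Lp \<Omega> q u"
    and "generates_multiscale_young_measure \<Omega> \<rho> \<epsilon> u \<nu>"
    and "admissible_integrand \<Omega> f"
    and "0 < c"
    and "\<And>x y z. x \<in> \<Omega> \<Longrightarrow> y \<in> unit_cubes \<Longrightarrow> f (x, y, z) \<le> c * (1 + norm z powr q)"
  shows "(\<integral>\<^sup>+ (x, y). (\<integral>\<^sup>+ z. ennreal (f (x, y, z)) \<partial>\<nu> (x, y)) \<partial>lebesgue_on (\<Omega> \<times> unit_cubes))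
    \<le> liminf (\<lambda>h. \<integral>\<^sup>+ x. ennreal (f (x, multiscale_map \<rho> \<epsilon> u h x)) \<partial>lebesgue_on \<Omega>)"
  using assms by (intro multiscale_young_measure_liminf[where q = q and c = c]) auto

end
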